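(* Let $\mathcal{G}=(B,\psi,A)$ be a connected $d$-regular undirected tracial quantum graph. The following are equivalent: (1) $\mathcal{G}$ is $loc$-$2$ colorable; (2) $\mathcal{G}$ is $alg$-$2$ colorable; (3) $\mathcal{G}$ has a symmetric spectrum, i.e. $\mathrm{spec}(A)=-\mathrm{spec}(A)$; (4) $-d\in\mathrm{spec}(A)$, where if $d=0$ it is additionally required that $\dim B\ge 2$; (5) $\mathcal{G}$ is bipartite. In this case, the symmetry of the spectrum in (3) holds with multiplicity.
   Context: A quantum set is a pair $(B,\psi)$ where $B$ is a finite-dimensional $C^*$-algebra with multiplication $m:B\otimes B\to B$, and $\psi$ is a faithful state on $B$ that is a $\delta$-form, i.e. $mm^\dagger=\delta^2\,\mathrm{id}_B$ for some $\delta\ge 0$. Here $B$ is regarded as the Hilbert space $L^2(B,\psi)$ with inner product $\langle x|y\rangle=\psi(x^*y)$, $B\otimes B$ carries the inner product from $\psi\otimes\psi$, and $(\cdot)^\dagger$ is the Hilbert space adjoint of operators. For linear maps $S,T:B\to B$, the Schur product is $S\bullet T=\delta^{-2}m(S\otimes T)m^\dagger$ and the involution is $T^*(x)=(T(x^* ))^*$. A quantum graph is a triple $\mathcal{G}=(B,\psi,A)$ with $(B,\psi)$ a quantum set and $A:B\to B$ linear satisfying $A\bullet A=A$. It is real if $A^*=A$; undirected if $A$ is real and $A=A^\dagger$; tracial if $\psi$ is a trace; $d$-regular ($d\in\mathbb{C}$) if $A1_B=d1_B=A^\dagger 1_B$. Its quantum relation is $\mathcal{S}=\{A\bullet T:T\in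 B(L^2(B,\psi))\}$. A graph homomorphism $f^{\mathrm{op}}:(B,\psi,A)\to(B',\psi',A')$ is a unital $*$-homomorphism $f:B'\to B$ with $A'\bullet(f^\dagger Af)=f^\dagger Af$ (Schur product on $(B',\psi')$, $f^\dagger$ the adjoint of $f:L^2(B',\psi')\to L^2(B,\psi)$). It is surjective if $f$ is injective. With $\tau(a,b)=(a+b)/2$ on $\mathbb{C}^2$, let $T_2=(\mathbb{C}^2,\tau,\mathrm{id})$ and $K_2=(\mathbb{C}^2,\tau,\begin{pmatrix}0&1\\1&0\end{pmatrix})$. $\mathcal{G}$ is connected if there is no surjective graph homomorphism $\mathcal{G}\to T_2$; bipartite if there is a surjective graph homomorphism $\mathcal{G}\to K_2$. Let $\mathcal{S}_{K_2}\subset B(L^2(\mathbb{C}^2,\tau))$ be the quantum relation of $K_2$ (the $2\times 2$ matrices with zero diagonal). $\mathcal{G}$ is $alg$-$2$ colorable if there exist a nonzero unital $*$-algebra $\mathcal{A}$ over $\mathbb{C}$ and a unital $*$-homomorphism $f:\mathbb{C}^2\to B\otimes\mathcal{A}$ such that $f^\dagger(\mathcal{S}\otimes 1_{\mathcal{A}})f\subset\mathcal{S}_{K_2}\otimes\mathcal{A}$; here $f$ is viewed as an element of $B(L^2(\mathbb{C}^2,\tau),L^2(B,\psi))\otimes\mathcal{A}$ and $f^\dagger$ is its image under $(\cdot)^\dagger\otimes(\cdot)^*$. $\mathcal{G}$ is $loc$-$2$ colorable if this is possible with $\mathcal{A}=\mathbb{C}$. (Injectivity of $f$ is not required.)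
   Formalization: The equivalence of (3) and (4) is stated only when dim B ≥ 2 or d ≠ 0; for B = ℂ, A = 0, d = 0 conditions (1)-(3) hold while (4) and (5) fail. The equivalences (1)-(3), (4)-(5) and the multiplicity claim are stated without restriction. *)

theory Defs
  imports "HOL-Analysis.Analysis" "HOL-Algebra.Module"
begin

section \<open>Finite-dimensional C*-algebras\<close>

class complex_star_algebra = ring_1 +
  fixes scaleC :: "complex \<Rightarrow> 'a \<Rightarrow> 'a"  (infixr \<open>*\<^sub>C\<close> 75)
    and star :: "'a \<Rightarrow> 'a"
  assumes scaleC_add_right: "c *\<^sub>C (x + y) = c *\<^sub>C x + c *\<^sub>C y"
    and scaleC_add_left: "(c + c') *\<^sub>C x = c *\<^sub>C x + c' *\<^sub>C x"
    and scaleC_scaleC: "c *\<^sub>C c' *\<^sub>C x = (c * c') *\<^sub>C x"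
    and scaleC_one: "1 *\<^sub>C x = x"
    and mult_scaleC_left: "(c *\<^sub>C x) * y = c *\<^sub>C (x * y)"
    and mult_scaleC_right: "x * (c *\<^sub>C y) = c *\<^sub>C (x * y)"
    and star_add: "star (x + y) = star x + star y"
    and star_scaleC: "star (c *\<^sub>C x) = cnj c *\<^sub>C star x"
    and star_mult: "star (x * y) = star y * star x"
    and star_star: "star (star x) = x"

definition (in complex_star_algebra) cstar_norm :: "('a \<Rightarrow> real) \<Rightarrow> bool" where
  "cstar_norm nrm \<longleftrightarrow>
     (\<forall>x. 0 \<le> nrm x) \<and> (\<forall>x. nrm x = 0 \<longleftrightarrow> x = 0) \<and>
     (\<forall>x y. nrm (x + y) \<le> nrm x + nrm y) \<and>
     (\<forall>c x. nrm (c *\<^sub>C x) = cmod c * nrm x) \<and>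
     (\<forall>x y. nrm (x * y) \<le> nrm x * nrm y) \<and>
     (\<forall>x. nrm (star x * x) = (nrm x)\<^sup>2)"

text \<open>The C*-norm of a C*-algebra is unique, so it is not a parameter of the class; in finite
  dimension completeness is automatic.\<close>

class fd_cstar_algebra = complex_star_algebra +
  assumes finite_dim: "\<exists>S. finite S \<and> (\<forall>x. \<exists>c. x = (\<Sum>s\<in>S. c s *\<^sub>C s))"
    and cstar: "\<exists>nrm. cstar_norm nrm"

instantiation complex :: complex_star_algebra
begin
definition scaleC_complex :: "complex \<Rightarrow> complex \<Rightarrow> complex" where "scaleC_complex = (*)"
definition star_complex :: "complex \<Rightarrow> complex" where "star_complex = cnj"
instance
  by standard (simp_all add: scaleC_complex_def star_complex_def algebra_simps)
end

text \<open>The library multiplication on \<open>complex ^ 'n\<close> is componentwise.\<close>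

instantiation vec :: (complex_star_algebra, finite) complex_star_algebra
begin
definition scaleC_vec :: "complex \<Rightarrow> 'a ^ 'b \<Rightarrow> 'a ^ 'b" where
  "scaleC_vec c x = (\<chi> i. c *\<^sub>C (x $ i))"
definition star_vec :: "'a ^ 'b \<Rightarrow> 'a ^ 'b" where
  "star_vec x = (\<chi> i. star (x $ i))"
instance
  by standard
    (simp_all add: scaleC_vec_def star_vec_def vec_eq_iff scaleC_add_right scaleC_add_left
      scaleC_scaleC scaleC_one mult_scaleC_left mult_scaleC_right star_add star_scaleC
      star_mult star_star)
end

abbreviation clinear :: "('a::complex_star_algebra \<Rightarrow> 'b::complex_star_algebra) \<Rightarrow> bool" where
  "clinear \<equiv> Vector_Spaces.linear (*\<^sub>C) (*\<^sub>C)"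

abbreviation cdim :: "'a::complex_star_algebra set \<Rightarrow> nat" where
  "cdim \<equiv> vector_space.dim (*\<^sub>C)"

definition unital_star_hom ::
    "('a::complex_star_algebra \<Rightarrow> 'b::complex_star_algebra) \<Rightarrow> bool" where
  "unital_star_hom f \<longleftrightarrow> clinear f \<and> f 1 = 1 \<and>
     (\<forall>x y. f (x * y) = f x * f y) \<and> (\<forall>x. f (star x) = star (f x))"

definition faithful_state :: "('a::complex_star_algebra \<Rightarrow> complex) \<Rightarrow> bool" where
  "faithful_state \<psi> \<longleftrightarrow> clinear \<psi> \<and> \<psi> 1 = 1 \<and>
     (\<forall>x. \<psi> (star x * x) \<in> \<real> \<and> 0 \<le> Re (\<psi> (star x * x))) \<and>
     (\<forall>x. \<psi> (star x * x) = 0 \<longrightarrow> x = 0)"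

definition tracial :: "('a::complex_star_algebra \<Rightarrow> complex) \<Rightarrow> bool" where
  "tracial \<psi> \<longleftrightarrow> (\<forall>x y. \<psi> (x * y) = \<psi> (y * x))"

section \<open>Algebraic tensor products\<close>

text \<open>
  An element of the tensor product of \<open>X\<close> and \<open>Y\<close> is represented by a formal finite sum of
  simple tensors, i.e. by a list of pairs. Two formal sums are the same tensor iff every bilinear
  form takes the same value on them: the dual of the tensor product is the space of bilinear
  forms, and over a field linear functionals separate points.
  Equalities between tensors are stated with \<open>tensor_eq\<close>, and functions into a tensor
  product choose representatives.
\<close>

record 'v cspace =
  vecs :: "'v set"
  vadd :: "'v \<Rightarrow> 'v \<Rightarrow> 'v"
  vscale :: "complex \<Rightarrow> 'v \<Rightarrow> 'v"

definition linear_form :: "'v cspace \<Rightarrow> ('v \<Rightarrow> complex) \<Rightarrow> bool" where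
  "linear_form X \<phi> \<longleftrightarrow>
     (\<forall>x\<in>vecs X. \<forall>y\<in>vecs X. \<phi> (vadd X x y) = \<phi> x + \<phi> y) \<and>
     (\<forall>c. \<forall>x\<in>vecs X. \<phi> (vscale X c x) = c * \<phi> x)"

definition bilinear_form :: "'v cspace \<Rightarrow> 'w cspace \<Rightarrow> ('v \<Rightarrow> 'w \<Rightarrow> complex) \<Rightarrow> bool" where
  "bilinear_form X Y \<beta> \<longleftrightarrow>
     (\<forall>y\<in>vecs Y. linear_form X (\<lambda>x. \<beta> x y)) \<and> (\<forall>x\<in>vecs X. linear_form Y (\<lambda>y. \<beta> x y))"

definition tensors :: "'v set \<Rightarrow> 'w set \<Rightarrow> ('v \<times> 'w) list set" where
  "tensors V W = {t. set t \<subseteq> V \<times> W}"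

definition tensor_eq ::
    "'v cspace \<Rightarrow> 'w cspace \<Rightarrow> ('v \<times> 'w) list \<Rightarrow> ('v \<times> 'w) list \<Rightarrow> bool" where
  "tensor_eq X Y s t \<longleftrightarrow> (\<forall>\<beta>. bilinear_form X Y \<beta> \<longrightarrow>
     (\<Sum>(x, y)\<leftarrow>s. \<beta> x y) = (\<Sum>(x, y)\<leftarrow>t. \<beta> x y))"

text \<open>\<open>tensor_map S T\<close> is the tensor product of two linear, or of two antilinear, maps.\<close>

definition tensor_map ::
    "('v \<Rightarrow> 'v') \<Rightarrow> ('w \<Rightarrow> 'w') \<Rightarrow> ('v \<times> 'w) list \<Rightarrow> ('v' \<times> 'w') list" where
  "tensor_map S T t = map (map_prod S T) t"

text \<open>The product on a tensor product induced by bilinear products \<open>p\<close>, \<open>q\<close> on the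
  factors: \<open>(v \<otimes> w) (v' \<otimes> w') = p v v' \<otimes> q w w'\<close>.\<close>

definition tensor_prod ::
    "('v \<Rightarrow> 'v' \<Rightarrow> 'v'') \<Rightarrow> ('w \<Rightarrow> 'w' \<Rightarrow> 'w'') \<Rightarrow>
     ('v \<times> 'w) list \<Rightarrow> ('v' \<times> 'w') list \<Rightarrow> ('v'' \<times> 'w'') list" where
  "tensor_prod p q s t = [(p x y, q a b). (x, a) \<leftarrow> s, (y, b) \<leftarrow> t]"

definition full_space :: "'b::complex_star_algebra cspace" where
  "full_space = \<lparr>vecs = UNIV, vadd = (+), vscale = (*\<^sub>C)\<rparr>"

definition hom_space :: "('b::complex_star_algebra \<Rightarrow> 'c::complex_star_algebra) cspace" where
  "hom_space = \<lparr>vecs = {T. clinear T}, vadd = (\<lambda>S T x. S x + T x), vscale = (\<lambda>c T x. c *\<^sub>C T x)\<rparr>"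

section \<open>Quantum sets\<close>

definition l2_inner :: "('b::complex_star_algebra \<Rightarrow> complex) \<Rightarrow> 'b \<Rightarrow> 'b \<Rightarrow> complex" where
  "l2_inner \<psi> x y = \<psi> (star x * y)"

definition adjoint_op ::
    "('b::complex_star_algebra \<Rightarrow> complex) \<Rightarrow> ('c::complex_star_algebra \<Rightarrow> complex) \<Rightarrow>
     ('b \<Rightarrow> 'c) \<Rightarrow> 'c \<Rightarrow> 'b" where
  "adjoint_op \<psi> \<psi>' T =
     (THE S. clinear S \<and> (\<forall>x y. l2_inner \<psi> (S y) x = l2_inner \<psi>' y (T x)))"

definition tensor_inner ::
    "('b::complex_star_algebra \<Rightarrow> complex) \<Rightarrow> ('b \<times> 'b) list \<Rightarrow> ('b \<times> 'b) list \<Rightarrow> complex" where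
  "tensor_inner \<psi> s t = (\<Sum>(x, y)\<leftarrow>s. \<Sum>(x', y')\<leftarrow>t. l2_inner \<psi> x x' * l2_inner \<psi> y y')"

definition mul :: "('b::complex_star_algebra \<times> 'b) list \<Rightarrow> 'b" where
  "mul t = (\<Sum>(x, y)\<leftarrow>t. x * y)"

definition mul_adjoint ::
    "('b::complex_star_algebra \<Rightarrow> complex) \<Rightarrow> 'b \<Rightarrow> ('b \<times> 'b) list" where
  "mul_adjoint \<psi> z = (SOME t. \<forall>s. tensor_inner \<psi> t s = l2_inner \<psi> z (mul s))"

definition delta_form :: "('b::complex_star_algebra \<Rightarrow> complex) \<Rightarrow> real \<Rightarrow> bool" where
  "delta_form \<psi> \<delta> \<longleftrightarrow> 0 \<le> \<delta> \<and> (\<forall>x. mul (mul_adjoint \<psi> x) = complex_of_real (\<delta>\<^sup>2) *\<^sub>C x)"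

definition quantum_set :: "('b::complex_star_algebra \<Rightarrow> complex) \<Rightarrow> bool" where
  "quantum_set \<psi> \<longleftrightarrow> faithful_state \<psi> \<and> (\<exists>\<delta>. delta_form \<psi> \<delta>)"

definition delta :: "('b::complex_star_algebra \<Rightarrow> complex) \<Rightarrow> real" where
  "delta \<psi> = (THE \<delta>. delta_form \<psi> \<delta>)"

section \<open>Quantum graphs\<close>

definition schur ::
    "('b::complex_star_algebra \<Rightarrow> complex) \<Rightarrow> ('b \<Rightarrow> 'b) \<Rightarrow> ('b \<Rightarrow> 'b) \<Rightarrow> 'b \<Rightarrow> 'b" where
  "schur \<psi> S T x =
     complex_of_real (1 / (delta \<psi>)\<^sup>2) *\<^sub>C mul (tensor_map S T (mul_adjoint \<psi> x))"

definition op_star :: "('b::complex_star_algebra \<Rightarrow> 'b) \<Rightarrow> 'b \<Rightarrow> 'b" where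
  "op_star T x = star (T (star x))"

definition quantum_graph ::
    "('b::complex_star_algebra \<Rightarrow> complex) \<Rightarrow> ('b \<Rightarrow> 'b) \<Rightarrow> bool" where
  "quantum_graph \<psi> A \<longleftrightarrow> quantum_set \<psi> \<and> clinear A \<and> schur \<psi> A A = A"

definition real_graph :: "('b::complex_star_algebra \<Rightarrow> 'b) \<Rightarrow> bool" where
  "real_graph A \<longleftrightarrow> op_star A = A"

definition undirected ::
    "('b::complex_star_algebra \<Rightarrow> complex) \<Rightarrow> ('b \<Rightarrow> 'b) \<Rightarrow> bool" where
  "undirected \<psi> A \<longleftrightarrow> real_graph A \<and> A = adjoint_op \<psi> \<psi> A"

definition regular ::
    "('b::complex_star_algebra \<Rightarrow> complex) \<Rightarrow> ('b \<Rightarrow> 'b) \<Rightarrow> complex \<Rightarrow> bool" where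
  "regular \<psi> A d \<longleftrightarrow> A 1 = d *\<^sub>C 1 \<and> adjoint_op \<psi> \<psi> A 1 = d *\<^sub>C 1"

definition quantum_relation ::
    "('b::complex_star_algebra \<Rightarrow> complex) \<Rightarrow> ('b \<Rightarrow> 'b) \<Rightarrow> ('b \<Rightarrow> 'b) set" where
  "quantum_relation \<psi> A = {schur \<psi> A T | T. clinear T}"

definition spec :: "('b::complex_star_algebra \<Rightarrow> 'b) \<Rightarrow> complex set" where
  "spec A = {c. \<not> bij (\<lambda>x. A x - c *\<^sub>C x)}"

text \<open>The geometric multiplicity; for a self-adjoint operator, such as the adjacency operator of
  an undirected quantum graph, it equals the algebraic one.\<close>

definition eigen_multiplicity :: "('b::complex_star_algebra \<Rightarrow> 'b) \<Rightarrow> complex \<Rightarrow> nat" where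
  "eigen_multiplicity A c = cdim {x. A x = c *\<^sub>C x}"

text \<open>\<open>graph_hom \<psi> A \<psi>' A' f\<close>: the map \<open>f\<close> of algebras defines a graph
  homomorphism \<open>f\<^sup>o\<^sup>p\<close> from the graph of \<open>(\<psi>, A)\<close> to the graph of \<open>(\<psi>', A')\<close>.\<close>

definition graph_hom ::
    "('b::complex_star_algebra \<Rightarrow> complex) \<Rightarrow> ('b \<Rightarrow> 'b) \<Rightarrow>
     ('c::complex_star_algebra \<Rightarrow> complex) \<Rightarrow> ('c \<Rightarrow> 'c) \<Rightarrow> ('c \<Rightarrow> 'b) \<Rightarrow> bool" where
  "graph_hom \<psi> A \<psi>' A' f \<longleftrightarrow> unital_star_hom f \<and>
     (let A\<^sub>f = adjoint_op \<psi>' \<psi> f \<circ> A \<circ> f in schur \<psi>' A' A\<^sub>f = A\<^sub>f)"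

definition surjective_graph_hom ::
    "('b::complex_star_algebra \<Rightarrow> complex) \<Rightarrow> ('b \<Rightarrow> 'b) \<Rightarrow>
     ('c::complex_star_algebra \<Rightarrow> complex) \<Rightarrow> ('c \<Rightarrow> 'c) \<Rightarrow> ('c \<Rightarrow> 'b) \<Rightarrow> bool" where
  "surjective_graph_hom \<psi> A \<psi>' A' f \<longleftrightarrow> graph_hom \<psi> A \<psi>' A' f \<and> inj f"

definition tau :: "complex ^ 2 \<Rightarrow> complex" where
  "tau x = (x $ 1 + x $ 2) / 2"

definition adj_T2 :: "complex ^ 2 \<Rightarrow> complex ^ 2" where
  "adj_T2 = id"

definition adj_K2 :: "complex ^ 2 \<Rightarrow> complex ^ 2" where
  "adj_K2 x = vector [vector [0, 1], vector [1, 0]] *v x"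

definition connected_graph ::
    "('b::complex_star_algebra \<Rightarrow> complex) \<Rightarrow> ('b \<Rightarrow> 'b) \<Rightarrow> bool" where
  "connected_graph \<psi> A \<longleftrightarrow> \<not> (\<exists>f. surjective_graph_hom \<psi> A tau adj_T2 f)"

definition bipartite ::
    "('b::complex_star_algebra \<Rightarrow> complex) \<Rightarrow> ('b \<Rightarrow> 'b) \<Rightarrow> bool" where
  "bipartite \<psi> A \<longleftrightarrow> (\<exists>f. surjective_graph_hom \<psi> A tau adj_K2 f)"

section \<open>Colorings\<close>

text \<open>The color algebra is existentially quantified, so it is a structure on a subset of a type
  rather than a type.\<close>

record 'u star_algebra = "(complex, 'u) module" +
  invol :: "'u \<Rightarrow> 'u"

definition complex_ring :: "complex ring" where
  "complex_ring = \<lparr>carrier = UNIV, mult = (*), one = 1, zero = 0, add = (+)\<rparr>"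

locale unital_star_algebra = ring \<A> + Module.module complex_ring \<A>
  for \<A> :: "'u star_algebra" (structure) +
  assumes smult_mult_left:
      "a \<in> carrier \<A> \<Longrightarrow> b \<in> carrier \<A> \<Longrightarrow> (c \<odot> a) \<otimes> b = c \<odot> (a \<otimes> b)"
    and smult_mult_right:
      "a \<in> carrier \<A> \<Longrightarrow> b \<in> carrier \<A> \<Longrightarrow> a \<otimes> (c \<odot> b) = c \<odot> (a \<otimes> b)"
    and invol_closed: "a \<in> carrier \<A> \<Longrightarrow> invol \<A> a \<in> carrier \<A>"
    and invol_add:
      "a \<in> carrier \<A> \<Longrightarrow> b \<in> carrier \<A> \<Longrightarrow> invol \<A> (a \<oplus> b) = invol \<A> a \<oplus> invol \<A> b"
    and invol_smult: "a \<in> carrier \<A> \<Longrightarrow> invol \<A> (c \<odot> a) = cnj c \<odot> invol \<A> a"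
    and invol_mult:
      "a \<in> carrier \<A> \<Longrightarrow> b \<in> carrier \<A> \<Longrightarrow> invol \<A> (a \<otimes> b) = invol \<A> b \<otimes> invol \<A> a"
    and invol_invol: "a \<in> carrier \<A> \<Longrightarrow> invol \<A> (invol \<A> a) = a"

definition complex_algebra :: "complex star_algebra" where
  "complex_algebra =
     \<lparr>carrier = UNIV, mult = (*), one = 1, zero = 0, add = (+), smult = (*), invol = cnj\<rparr>"

definition algebra_space :: "'u star_algebra \<Rightarrow> 'u cspace" where
  "algebra_space \<A> =
     \<lparr>vecs = carrier \<A>, vadd = add \<A>, vscale = smult \<A>\<rparr>"

definition tensor_star_hom ::
    "'u star_algebra \<Rightarrow> ('c::complex_star_algebra \<Rightarrow> ('b::complex_star_algebra \<times> 'u) list) \<Rightarrow> bool"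
  where
  "tensor_star_hom \<A> f \<longleftrightarrow>
     (let eq = tensor_eq full_space (algebra_space \<A>) in
      (\<forall>x. f x \<in> tensors UNIV (carrier \<A>)) \<and>
      (\<forall>x y. eq (f (x + y)) (f x @ f y)) \<and>
      (\<forall>c x. eq (f (c *\<^sub>C x)) (tensor_map ((*\<^sub>C) c) id (f x))) \<and>
      eq (f 1) [(1, \<one>\<^bsub>\<A>\<^esub>)] \<and>
      (\<forall>x y. eq (f (x * y)) (tensor_prod (*) (mult \<A>) (f x) (f y))) \<and>
      (\<forall>x. eq (f (star x)) (tensor_map star (invol \<A>) (f x))))"

text \<open>\<open>represents \<A> F f\<close>: the element \<open>F\<close> of \<open>Hom(C, B) \<otimes> \<A>\<close> is the linear
  map \<open>f : C \<rightarrow> B \<otimes> \<A>\<close> under the canonical isomorphism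
  \<open>T \<otimes> a \<mapsto> (x \<mapsto> T x \<otimes> a)\<close>.\<close>

definition represents ::
    "'u star_algebra \<Rightarrow> (('c::complex_star_algebra \<Rightarrow> 'b::complex_star_algebra) \<times> 'u) list \<Rightarrow>
     ('c \<Rightarrow> ('b \<times> 'u) list) \<Rightarrow> bool" where
  "represents \<A> F f \<longleftrightarrow> F \<in> tensors {T. clinear T} (carrier \<A>) \<and>
     (\<forall>x. tensor_eq full_space (algebra_space \<A>) (tensor_map (\<lambda>T. T x) id F) (f x))"

definition two_coloring ::
    "('b::complex_star_algebra \<Rightarrow> complex) \<Rightarrow> ('b \<Rightarrow> 'b) \<Rightarrow> 'u star_algebra \<Rightarrow>
     (complex ^ 2 \<Rightarrow> ('b \<times> 'u) list) \<Rightarrow> bool" where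
  "two_coloring \<psi> A \<A> f \<longleftrightarrow> tensor_star_hom \<A> f \<and>
     (\<exists>F. represents \<A> F f \<and>
       (\<forall>S\<in>quantum_relation \<psi> A. \<exists>G\<in>tensors (quantum_relation tau adj_K2) (carrier \<A>).
          tensor_eq hom_space (algebra_space \<A>)
            (tensor_prod (\<circ>) (mult \<A>) (tensor_map (adjoint_op tau \<psi>) (invol \<A>) F)
              (tensor_prod (\<circ>) (mult \<A>) [(S, \<one>\<^bsub>\<A>\<^esub>)] F))
            G))"

text \<open>The type \<open>'u\<close> is the universe from which the elements of the color algebra are drawn.
  Any algebra can be copied into a large enough universe, so statements are to be made for every
  \<open>'u\<close> large enough to hold the smallest nonzero complex algebra, i.e. for every \<open>'u\<close>
  into which \<open>complex\<close> can be injected.\<close>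

definition alg_2_colorable ::
    "'u itself \<Rightarrow> ('b::complex_star_algebra \<Rightarrow> complex) \<Rightarrow> ('b \<Rightarrow> 'b) \<Rightarrow> bool" where
  "alg_2_colorable _ \<psi> A \<longleftrightarrow>
     (\<exists>\<A> :: 'u star_algebra. unital_star_algebra \<A> \<and> carrier \<A> \<noteq> {\<zero>\<^bsub>\<A>\<^esub>} \<and>
        (\<exists>f. two_coloring \<psi> A \<A> f))"

definition loc_2_colorable ::
    "('b::complex_star_algebra \<Rightarrow> complex) \<Rightarrow> ('b \<Rightarrow> 'b) \<Rightarrow> bool" where
  "loc_2_colorable \<psi> A \<longleftrightarrow> (\<exists>f. two_coloring \<psi> A complex_algebra f)"

end

theory Submission
  imports Defs "HOL-Computational_Algebra.Fundamental_Theorem_Algebra"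
begin

text \<open>
  The five conditions are compared with one algebraic condition: there is a projection \<open>p\<close> in \<open>B\<close>
  with \<open>A (p b) = (1 - p) (A b)\<close> for all \<open>b\<close>. Such a \<open>p\<close> is called a bipartition below. The symmetry
  \<open>u = p - (1 - p)\<close> then satisfies \<open>A (u b) = - u (A b)\<close> and \<open>u\<^sup>2 = 1\<close>, so multiplication by \<open>u\<close>
  exchanges the eigenspaces of \<open>c\<close> and \<open>- c\<close>; this is the symmetry of the spectrum with
  multiplicity (\<open>eigen_multiplicity_symmetric\<close>), and \<open>u\<close> itself is an eigenvector for \<open>- d\<close>.

  The calculations rest on the identity \<open>\<Sum>e. A (x e) A (e\<^sup>* y) = \<delta>\<^sup>2 A (x y)\<close> (\<open>sum_A_A\<close>), the sum
  being over an orthonormal basis or, more generally, a Parseval frame of \<open>L\<^sup>2(B, \<psi>)\<close>. It is Schur idempotence together with the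
  formula \<open>m\<^sup>\<dagger> x = \<Sum>e. x e \<otimes> e\<^sup>*\<close> for a trace. As \<open>A\<close> is real, it exhibits weights such as
  \<open>\<psi> (p A q)\<close> as sums of squares. A weight between two projections can therefore only vanish if the
  whole block \<open>b \<mapsto> p A (q b)\<close> vanishes (\<open>zero_block\<close>). A homomorphism to \<open>K\<^sub>2\<close> is a projection \<open>p\<close>
  for which the weights from \<open>p\<close> to \<open>p\<close> and from \<open>1 - p\<close> to \<open>1 - p\<close> vanish, so it is the same
  as a bipartition (\<open>bipartition_iff\<close>); it is surjective if \<open>p\<close> is neither \<open>0\<close> nor \<open>1\<close>.

  Let \<open>- d\<close> be an eigenvalue. There is a self-adjoint eigenvector \<open>x\<close> with \<open>\<psi> x = 0\<close>: if
  \<open>d \<noteq> 0\<close>, then \<open>\<psi> A = d \<psi>\<close> forces \<open>\<psi> x = 0\<close>, and if \<open>d = 0\<close>, then \<open>A = 0\<close> and any \<open>x\<close> in the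
  kernel of \<open>\<psi>\<close> will do, which is where the dimension has to be at least \<open>2\<close>. The identity shows that
  \<open>\<Sum>e. \<parallel>A (x e) + x (A e)\<parallel>\<^sup>2 = 0\<close>, so that \<open>x\<close> anticommutes with \<open>A\<close>
  (\<open>extremal_eigenvector_anticommutes\<close>). Then \<open>x\<^sup>2\<close> commutes with \<open>A\<close>. If \<open>x\<^sup>2\<close> were not a scalar,
  one of its spectral projections would disconnect the graph. So \<open>x\<close> may be scaled to \<open>x\<^sup>2 = 1\<close>, and
  \<open>(1 + x) / 2\<close> is a bipartition other than \<open>0\<close> and \<open>1\<close> (\<open>bipartition_of_self_adjoint_eigenvector\<close>).

  A bipartition is a coloring with values in any color algebra. Conversely, a coloring with values
  in \<open>\<A>\<close> is a pair of projections \<open>P + Q = 1\<close> in \<open>B \<otimes> \<A>\<close> for which the blocks of \<open>A \<otimes> 1\<close> from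
  \<open>P\<close> to \<open>P\<close> and from \<open>Q\<close> to \<open>Q\<close> vanish (\<open>coloring_zero_block\<close>). Hence \<open>P - Q\<close> anticommutes with
  \<open>A \<otimes> 1\<close> just as \<open>u\<close> does with \<open>A\<close>, and it carries an eigenvector \<open>x \<otimes> 1\<close> for \<open>c\<close> to a nonzero
  eigenvector of \<open>A \<otimes> 1\<close> for \<open>- c\<close>. The slices of the latter are in \<open>B\<close>, so the spectrum of \<open>A\<close> is
  symmetric (\<open>spec_symmetric_of_coloring\<close>). Finally \<open>d\<close> is always an eigenvalue, with
  eigenvector \<open>1\<close>, so a symmetric spectrum contains \<open>- d\<close>.
\<close>

section \<open>Linear algebra over star algebras\<close>

interpretation cvs: vector_space "(*\<^sub>C) :: complex \<Rightarrow> 'a \<Rightarrow> 'a::complex_star_algebra"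
  by standard (simp_all add: scaleC_add_right scaleC_add_left scaleC_scaleC scaleC_one)

lemma clinear_iff:
  "clinear f \<longleftrightarrow> (\<forall>x y. f (x + y) = f x + f y) \<and> (\<forall>c x. f (c *\<^sub>C x) = c *\<^sub>C f x)"
  unfolding Vector_Spaces.linear_iff by (simp add: cvs.vector_space_axioms)

lemma clinear_add: "clinear f \<Longrightarrow> f (x + y) = f x + f y"
  by (simp add: clinear_iff)

lemma clinear_scale: "clinear f \<Longrightarrow> f (c *\<^sub>C x) = c *\<^sub>C f x"
  by (simp add: clinear_iff)

lemma clinear_zero: "clinear f \<Longrightarrow> f 0 = 0"
  using clinear_add[of f 0 0] by simp

lemma clinear_minus: "clinear f \<Longrightarrow> f (- x) = - f x"
  using clinear_add[of f x "- x"] clinear_zero[of f] by (simp add: eq_neg_iff_add_eq_0 add.commute)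

lemma clinear_diff: "clinear f \<Longrightarrow> f (x - y) = f x - f y"
  using clinear_add[of f x "- y"] clinear_minus[of f y] by simp

lemma clinear_sum: "clinear f \<Longrightarrow> f (\<Sum>i\<in>I. g i) = (\<Sum>i\<in>I. f (g i))"
  by (induction I rule: infinite_finite_induct) (simp_all add: clinear_zero clinear_add)

lemma scaleC_complex [simp]: "c *\<^sub>C z = c * (z :: complex)"
  by (simp add: scaleC_complex_def)

lemma star_complex [simp]: "star (z :: complex) = cnj z"
  by (simp add: star_complex_def)

lemma star_zero [simp]: "star (0 :: 'a::complex_star_algebra) = 0"
  using star_add[of "0 :: 'a" 0] by simp

lemma star_minus: "star (- x :: 'a::complex_star_algebra) = - star x"
  using star_add[of x "- x"] by (simp add: eq_neg_iff_add_eq_0 add.commute)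

lemma star_diff: "star (x - y :: 'a::complex_star_algebra) = star x - star y"
  using star_add[of x "- y"] by (simp add: star_minus)

lemma star_one [simp]: "star (1 :: 'a::complex_star_algebra) = 1"
  using star_mult[of "star (1 :: 'a)" 1] by (simp add: star_star)

lemma star_sum: "star (\<Sum>i\<in>I. g i :: 'a::complex_star_algebra) = (\<Sum>i\<in>I. star (g i))"
  by (induction I rule: infinite_finite_induct) (simp_all add: star_add)

lemmas star_simps = star_add star_diff star_minus star_mult star_star star_scaleC

lemmas scaleC_mult_simps = mult_scaleC_left mult_scaleC_right scaleC_scaleC

section \<open>Parseval frames of the GNS space\<close>

text \<open>The formulas for adjoints and for \<open>m\<^sup>\<dagger>\<close> rest on one property of an orthonormal basis of
  \<open>L\<^sup>2(B, \<psi>)\<close>, the expansion \<open>x = \<Sum>e. \<langle>e|x\<rangle> e\<close>. Families with this property are called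
  Parseval frames.\<close>

locale parseval_frame =
  fixes \<psi> :: "'b::complex_star_algebra \<Rightarrow> complex" and E :: "'b set"
  assumes state: "faithful_state \<psi>"
    and finite_frame: "finite E"
    and frame_expansion: "x = (\<Sum>e\<in>E. \<psi> (star e * x) *\<^sub>C e)"

lemma faithful_stateD:
  assumes "faithful_state \<psi>"
  shows "clinear \<psi>" "\<psi> 1 = 1" "\<psi> (star x * x) \<in> \<real>" "0 \<le> Re (\<psi> (star x * x))"
    "\<psi> (star x * x) = 0 \<longleftrightarrow> x = 0"
  using assms clinear_zero[of \<psi>] by (auto simp: faithful_state_def)

text \<open>Polarization: \<open>\<psi>\<close> is real on the squares of \<open>x + 1\<close> and of \<open>x + \<i>\<close>, which ties the imaginary
  and the real part of \<open>\<psi> (x\<^sup>*)\<close> to those of \<open>\<psi> x\<close>.\<close>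

lemma state_star:
  assumes "faithful_state \<psi>"
  shows "\<psi> (star x) = cnj (\<psi> x)"
proof -
  note lin = clinear_add[OF faithful_stateD(1)[OF assms]] clinear_scale[OF faithful_stateD(1)[OF assms]]
  have r: "Im (\<psi> (star y * y)) = 0" for y
    using faithful_stateD(3)[OF assms] by (simp add: complex_is_Real_iff)
  have "star (x + 1) * (x + 1) = star x * x + (star x + x + 1)"
    by (simp add: star_simps algebra_simps)
  then have 1: "Im (\<psi> (star x)) + Im (\<psi> x) = 0"
    using r[of "x + 1"] r[of x] r[of 1] by (simp add: lin)
  have "star (x + \<i> *\<^sub>C 1) * (x + \<i> *\<^sub>C 1) = star x * x + (\<i> *\<^sub>C star x + (-\<i>) *\<^sub>C x + 1)"
    by (simp add: star_simps algebra_simps scaleC_mult_simps)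
  then have 2: "Re (\<psi> (star x)) - Re (\<psi> x) = 0"
    using r[of "x + \<i> *\<^sub>C 1"] r[of x] r[of 1]
    by (simp add: lin clinear_diff[OF faithful_stateD(1)[OF assms]])
  show ?thesis using 1 2 by (simp add: complex_eq_iff)
qed

lemma l2_inner_add: "faithful_state \<psi> \<Longrightarrow> l2_inner \<psi> x (y + z) = l2_inner \<psi> x y + l2_inner \<psi> x z"
  by (simp add: l2_inner_def distrib_left clinear_add[OF faithful_stateD(1)])

text \<open>The part \<open>r\<close> of a new vector that is orthogonal to \<open>E\<close> is normalized and added to \<open>E\<close>;
  the expansions of the earlier vectors survive, since \<open>r\<close> is orthogonal to them.\<close>

lemma gram_schmidt:
  assumes st: "faithful_state \<psi>" and "finite S"
  shows "\<exists>E. finite E \<and> (\<forall>a\<in>E. \<forall>b\<in>E. \<psi> (star a * b) = (if a = b then 1 else 0)) \<and>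
    (\<forall>s\<in>S. s = (\<Sum>e\<in>E. \<psi> (star e * s) *\<^sub>C e))"
  using \<open>finite S\<close>
proof (induction S rule: finite_induct)
  case empty
  show ?case by (rule exI[of _ "{}"]) simp
next
  case (insert s S)
  then obtain E where E: "finite E" "\<And>a b. a \<in> E \<Longrightarrow> b \<in> E \<Longrightarrow> \<psi> (star a * b) = (if a = b then 1 else 0)"
    "\<And>s. s \<in> S \<Longrightarrow> s = (\<Sum>e\<in>E. \<psi> (star e * s) *\<^sub>C e)" by blast
  note lin = clinear_add[OF faithful_stateD(1)[OF st]] clinear_scale[OF faithful_stateD(1)[OF st]]
    clinear_diff[OF faithful_stateD(1)[OF st]] clinear_sum[OF faithful_stateD(1)[OF st]]
  define r where "r = s - (\<Sum>e\<in>E. \<psi> (star e * s) *\<^sub>C e)"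
  show ?case
  proof (cases "r = 0")
    case True
    then show ?thesis using E unfolding r_def by (intro exI[of _ E]) simp
  next
    case False
    have orth: "\<psi> (star a * r) = 0" if "a \<in> E" for a
      using that E(1)
      by (simp add: r_def right_diff_distrib sum_distrib_left lin mult_scaleC_right E(2) if_distrib
          cong: if_cong)
    then have orth': "\<psi> (star r * a) = 0" if "a \<in> E" for a
      using that state_star[OF st, of "star a * r"] by (simp add: star_simps)
    define n where "n = sqrt (Re (\<psi> (star r * r)))"
    have n2: "\<psi> (star r * r) = complex_of_real (n\<^sup>2)"
      using faithful_stateD(3,4)[OF st, of r] unfolding n_def by (simp add: complex_eq_iff complex_is_Real_iff)
    have n0: "n \<noteq> 0" using False n2 faithful_stateD(5)[OF st, of r] by auto
    define u where "u = complex_of_real (1 / n) *\<^sub>C r"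
    have uu: "\<psi> (star u * u) = 1"
      using n0 by (simp add: u_def star_simps scaleC_mult_simps lin n2 power2_eq_square)
    have uE: "\<psi> (star u * a) = 0" "\<psi> (star a * u) = 0" if "a \<in> E" for a
      using that orth orth' by (simp_all add: u_def star_simps scaleC_mult_simps lin)
    have unE: "u \<notin> E" using uu uE by force
    have ru: "r = \<psi> (star u * s) *\<^sub>C u"
    proof -
      have "s = r + (\<Sum>e\<in>E. \<psi> (star e * s) *\<^sub>C e)" by (simp add: r_def)
      then have "\<psi> (star u * s) = \<psi> (star u * r) + \<psi> (star u * (\<Sum>e\<in>E. \<psi> (star e * s) *\<^sub>C e))"
        by (metis lin(1) distrib_left)
      also have "\<dots> = \<psi> (star u * r)"
        by (simp add: sum_distrib_left lin mult_scaleC_right uE)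
      also have "\<dots> = complex_of_real n"
        using n0 by (simp add: u_def star_simps scaleC_mult_simps lin n2 power2_eq_square)
      finally show ?thesis using n0 by (simp add: u_def scaleC_mult_simps scaleC_one)
    qed
    have "\<forall>a\<in>insert u E. \<forall>b\<in>insert u E. \<psi> (star a * b) = (if a = b then 1 else 0)"
      using E(2) uu uE unE by auto
    moreover have "t = (\<Sum>e\<in>insert u E. \<psi> (star e * t) *\<^sub>C e)" if "t \<in> insert s S" for t
    proof (cases "t = s")
      case True
      have "s = r + (\<Sum>e\<in>E. \<psi> (star e * s) *\<^sub>C e)" by (simp add: r_def)
      then show ?thesis using True unE E(1) ru by simp
    next
      case False
      then have t: "t \<in> S" using that by simp
      have "\<psi> (star u * t) = \<psi> (star u * (\<Sum>e\<in>E. \<psi> (star e * t) *\<^sub>C e))"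
        using E(3)[OF t] by simp
      also have "\<dots> = 0" by (simp add: sum_distrib_left lin mult_scaleC_right uE)
      finally show ?thesis using E(3)[OF t] unE E(1) by simp
    qed
    ultimately show ?thesis using E(1) by (intro exI[of _ "insert u E"]) blast
  qed
qed

lemma parseval_frame_exists:
  fixes \<psi> :: "'b::fd_cstar_algebra \<Rightarrow> complex"
  assumes st: "faithful_state \<psi>"
  shows "\<exists>E. parseval_frame \<psi> E"
proof -
  obtain S :: "'b set" where S: "finite S" "\<And>x. \<exists>c. x = (\<Sum>s\<in>S. c s *\<^sub>C s)"
    using finite_dim by blast
  obtain E where E: "finite E" "\<And>s. s \<in> S \<Longrightarrow> s = (\<Sum>e\<in>E. \<psi> (star e * s) *\<^sub>C e)"
    using gram_schmidt[OF st S(1)] by blast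
  note lin = clinear_scale[OF faithful_stateD(1)[OF st]] clinear_sum[OF faithful_stateD(1)[OF st]]
  have "x = (\<Sum>e\<in>E. \<psi> (star e * x) *\<^sub>C e)" for x
  proof -
    obtain c where c: "x = (\<Sum>s\<in>S. c s *\<^sub>C s)" using S(2) by blast
    have "(\<Sum>e\<in>E. \<psi> (star e * x) *\<^sub>C e) = (\<Sum>e\<in>E. \<Sum>s\<in>S. (c s * \<psi> (star e * s)) *\<^sub>C e)"
      by (simp add: c sum_distrib_left lin mult_scaleC_right cvs.scale_sum_left)
    also have "\<dots> = (\<Sum>s\<in>S. c s *\<^sub>C (\<Sum>e\<in>E. \<psi> (star e * s) *\<^sub>C e))"
      by (subst sum.swap) (simp add: cvs.scale_sum_right scaleC_scaleC)
    also have "\<dots> = x" unfolding c using E(2) by (intro sum.cong) auto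
    finally show ?thesis by simp
  qed
  then show ?thesis using st E(1) by (intro exI[of _ E] parseval_frame.intro) auto
qed

context parseval_frame
begin

lemma lin: "clinear \<psi>" by (rule faithful_stateD(1)[OF state])

lemmas psi_add = clinear_add[OF lin] and psi_scale = clinear_scale[OF lin]
  and psi_sum = clinear_sum[OF lin] and psi_diff = clinear_diff[OF lin]
  and psi_zero = clinear_zero[OF lin]

lemma inner_nondegenerate: "(\<And>y. \<psi> (star x * y) = 0) \<Longrightarrow> x = 0"
  using faithful_stateD(5)[OF state, of x] by simp

text \<open>The adjoint is \<open>y \<mapsto> \<Sum>e. \<langle>T e|y\<rangle> e\<close>.\<close>

lemma adjoint_op:
  assumes st': "faithful_state \<psi>'" and T: "clinear T"
  shows "clinear (adjoint_op \<psi> \<psi>' T)"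
    and "l2_inner \<psi> (adjoint_op \<psi> \<psi>' T y) x = l2_inner \<psi>' y (T x)"
proof -
  note lin' = clinear_add[OF faithful_stateD(1)[OF st']] clinear_scale[OF faithful_stateD(1)[OF st']]
    clinear_sum[OF faithful_stateD(1)[OF st']]
  define S where "S y = (\<Sum>e\<in>E. \<psi>' (star (T e) * y) *\<^sub>C e)" for y
  have S1: "clinear S"
    by (auto simp: clinear_iff S_def distrib_left lin' scaleC_add_left sum.distrib mult_scaleC_right
        cvs.scale_sum_right scaleC_scaleC)
  have S2: "l2_inner \<psi> (S y) x = l2_inner \<psi>' y (T x)" for x y
  proof -
    have "l2_inner \<psi> (S y) x = (\<Sum>e\<in>E. cnj (\<psi>' (star (T e) * y)) * \<psi> (star e * x))"
      by (simp add: l2_inner_def S_def star_sum star_scaleC sum_distrib_right mult_scaleC_left psi_sum psi_scale)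
    also have "\<dots> = (\<Sum>e\<in>E. \<psi>' (star y * T e) * \<psi> (star e * x))"
      by (simp add: state_star[OF st', symmetric] star_simps)
    also have "\<dots> = \<psi>' (star y * T (\<Sum>e\<in>E. \<psi> (star e * x) *\<^sub>C e))"
      by (simp add: clinear_sum[OF T] clinear_scale[OF T] lin' sum_distrib_left mult_scaleC_right mult.commute)
    also have "\<dots> = l2_inner \<psi>' y (T x)"
      unfolding frame_expansion[of x, symmetric] l2_inner_def ..
    finally show ?thesis .
  qed
  have "adjoint_op \<psi> \<psi>' T = S"
    unfolding adjoint_op_def
  proof (rule the_equality)
    fix S' assume S': "clinear S' \<and> (\<forall>x y. l2_inner \<psi> (S' y) x = l2_inner \<psi>' y (T x))"
    have "S' y - S y = 0" for y
    proof (rule inner_nondegenerate)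
      fix z show "\<psi> (star (S' y - S y) * z) = 0"
        using S' S2[of y z] by (simp add: star_diff left_diff_distrib psi_diff l2_inner_def)
    qed
    then show "S' = S" by (auto simp: fun_eq_iff)
  qed (use S1 S2 in auto)
  then show "clinear (adjoint_op \<psi> \<psi>' T)" "l2_inner \<psi> (adjoint_op \<psi> \<psi>' T y) x = l2_inner \<psi>' y (T x)"
    using S1 S2 by auto
qed

end

section \<open>The adjoint of multiplication and the Schur product\<close>

text \<open>Pairing a tensor with the frame gives its coordinates, so tensors with the same inner
  products have the same image under every bilinear map.\<close>

lemma (in parseval_frame) bilinear_expansion:
  fixes \<beta> :: "'b \<Rightarrow> 'b \<Rightarrow> 'c::complex_star_algebra"
  assumes l: "\<And>y. clinear (\<lambda>x. \<beta> x y)" and r: "\<And>x. clinear (\<beta> x)"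
  shows "(\<Sum>(x, y)\<leftarrow>t. \<beta> x y) =
    (\<Sum>e\<in>E. \<Sum>e'\<in>E. cnj (tensor_inner \<psi> t [(e, e')]) *\<^sub>C \<beta> e e')"
proof (induction t)
  case Nil
  show ?case by (simp add: tensor_inner_def)
next
  case (Cons xy t)
  obtain x y where xy: "xy = (x, y)" by force
  have c: "cnj (l2_inner \<psi> a b) = \<psi> (star b * a)" for a b
    by (simp add: l2_inner_def state_star[OF state, symmetric] star_simps)
  have "\<beta> x y = \<beta> (\<Sum>e\<in>E. \<psi> (star e * x) *\<^sub>C e) (\<Sum>e\<in>E. \<psi> (star e * y) *\<^sub>C e)"
    using frame_expansion[of x] frame_expansion[of y] by simp
  also have "\<dots> = (\<Sum>e\<in>E. \<psi> (star e * x) *\<^sub>C \<beta> e (\<Sum>e\<in>E. \<psi> (star e * y) *\<^sub>C e))"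
    by (simp only: clinear_sum[OF l] clinear_scale[OF l])
  also have "\<dots> = (\<Sum>e\<in>E. \<Sum>e'\<in>E. (\<psi> (star e * x) * \<psi> (star e' * y)) *\<^sub>C \<beta> e e')"
    by (simp only: clinear_sum[OF r] clinear_scale[OF r] cvs.scale_sum_right scaleC_scaleC)
  finally show ?case using Cons.IH
    by (simp add: xy tensor_inner_def c scaleC_add_left sum.distrib)
qed

locale tracial_frame = parseval_frame \<psi> E
  for \<psi> :: "'b::complex_star_algebra \<Rightarrow> complex" and E +
  assumes trace: "\<psi> (x * y) = \<psi> (y * x)"
begin

lemma frame_expansion_right: "x = (\<Sum>e\<in>E. \<psi> (x * e) *\<^sub>C star e)"
proof -
  have "star (star x) = star (\<Sum>e\<in>E. \<psi> (star e * star x) *\<^sub>C e)"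
    using frame_expansion[of "star x"] by simp
  also have "\<dots> = (\<Sum>e\<in>E. \<psi> (x * e) *\<^sub>C star e)"
    by (simp add: star_sum star_simps state_star[OF state, symmetric])
  finally show ?thesis by (simp add: star_star)
qed

text \<open>For a trace, \<open>m\<^sup>\<dagger> z = \<Sum>e. z e \<otimes> e\<^sup>*\<close>: the inner product of the right-hand side with
  \<open>x \<otimes> y\<close> is \<open>\<Sum>e. \<psi> (e\<^sup>* z\<^sup>* x) \<psi> (e y)\<close>, which the frame expansion of \<open>z\<^sup>* x\<close> contracts to
  \<open>\<langle>z|x y\<rangle>\<close>. The representative chosen by \<open>mul_adjoint\<close> is another one of the same tensor.\<close>

lemma sum_mul_adjoint:
  fixes \<beta> :: "'b \<Rightarrow> 'b \<Rightarrow> 'c::complex_star_algebra"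
  assumes l: "\<And>y. clinear (\<lambda>x. \<beta> x y)" and r: "\<And>x. clinear (\<beta> x)"
  shows "(\<Sum>(x, y)\<leftarrow>mul_adjoint \<psi> z. \<beta> x y) = (\<Sum>e\<in>E. \<beta> (z * e) (star e))"
proof -
  obtain es where es: "set es = E" "distinct es" using finite_distinct_list[OF finite_frame] by blast
  define t where "t = map (\<lambda>e. (z * e, star e)) es"
  have sum_t: "(\<Sum>(x, y)\<leftarrow>t. \<gamma> x y) = (\<Sum>e\<in>E. \<gamma> (z * e) (star e))"
    for \<gamma> :: "'b \<Rightarrow> 'b \<Rightarrow> 'd::comm_monoid_add"
    using sum_list_distinct_conv_sum_set[OF es(2), of "\<lambda>e. \<gamma> (z * e) (star e)"]
    by (simp add: t_def es o_def)
  have "tensor_inner \<psi> t s = l2_inner \<psi> z (mul s)" for s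
  proof (induction s)
    case Nil
    have "(\<Sum>(x, y)\<leftarrow>t. 0 :: complex) = 0" by (simp add: case_prod_unfold)
    then show ?case by (simp add: tensor_inner_def mul_def l2_inner_def psi_zero)
  next
    case (Cons xy s)
    obtain x y where xy: "xy = (x, y)" by force
    have "(\<Sum>e\<in>E. l2_inner \<psi> (z * e) x * l2_inner \<psi> (star e) y)
        = \<psi> ((\<Sum>e\<in>E. \<psi> (star e * (star z * x)) *\<^sub>C e) * y)"
      by (simp add: l2_inner_def sum_distrib_right psi_sum mult_scaleC_left psi_scale star_simps mult.assoc)
    also have "\<dots> = l2_inner \<psi> z (x * y)"
      unfolding frame_expansion[of "star z * x", symmetric] by (simp add: l2_inner_def mult.assoc)
    finally have "(\<Sum>e\<in>E. l2_inner \<psi> (z * e) x * l2_inner \<psi> (star e) y) = l2_inner \<psi> z (x * y)" .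
    then show ?case using Cons.IH
      by (simp add: xy tensor_inner_def sum_t mul_def sum.distrib l2_inner_add[OF state])
  qed
  then have "\<exists>t. \<forall>s. tensor_inner \<psi> t s = l2_inner \<psi> z (mul s)" by blast
  then have "tensor_inner \<psi> (mul_adjoint \<psi> z) s = l2_inner \<psi> z (mul s)" for s
    unfolding mul_adjoint_def by (rule someI2_ex) blast
  then have "tensor_inner \<psi> (mul_adjoint \<psi> z) s = tensor_inner \<psi> t s" for s
    using \<open>\<And>s. tensor_inner \<psi> t s = _\<close> by simp
  then have "(\<Sum>(x, y)\<leftarrow>mul_adjoint \<psi> z. \<beta> x y) = (\<Sum>(x, y)\<leftarrow>t. \<beta> x y)"
    by (simp add: bilinear_expansion[OF l r])
  then show ?thesis by (simp add: sum_t)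
qed

lemma schur_eq_sum:
  assumes S: "clinear S" and T: "clinear T"
  shows "schur \<psi> S T x = complex_of_real (1 / (delta \<psi>)\<^sup>2) *\<^sub>C (\<Sum>e\<in>E. S (x * e) * T (star e))"
proof -
  have "mul (tensor_map S T (mul_adjoint \<psi> x)) = (\<Sum>(y, z)\<leftarrow>mul_adjoint \<psi> x. S y * T z)"
    by (simp add: mul_def tensor_map_def o_def case_prod_unfold)
  also have "\<dots> = (\<Sum>e\<in>E. S (x * e) * T (star e))"
    by (rule sum_mul_adjoint)
      (auto simp: clinear_iff distrib_left distrib_right mult_scaleC_left mult_scaleC_right
        clinear_add[OF S] clinear_add[OF T] clinear_scale[OF S] clinear_scale[OF T])
  finally show ?thesis by (simp add: schur_def)
qed

text \<open>\<open>m\<^sup>\<dagger>\<close> is a map of bimodules: left multiplication of the frame by \<open>y\<close> and right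
  multiplication of its adjoint by \<open>y\<close> have the same matrix \<open>\<psi> (f\<^sup>* y e)\<close>.\<close>

lemma frame_bimodule:
  assumes S: "clinear S" and T: "clinear T"
  shows "(\<Sum>e\<in>E. S (x * y * e) * T (star e)) = (\<Sum>e\<in>E. S (x * e) * T (star e * y))"
proof -
  have "(\<Sum>e\<in>E. S (x * y * e) * T (star e))
      = (\<Sum>e\<in>E. S (x * (\<Sum>f\<in>E. \<psi> (star f * (y * e)) *\<^sub>C f)) * T (star e))"
    unfolding frame_expansion[of "y * _", symmetric] by (simp add: mult.assoc)
  also have "\<dots> = (\<Sum>e\<in>E. \<Sum>f\<in>E. \<psi> (star f * y * e) *\<^sub>C (S (x * f) * T (star e)))"
    by (simp add: sum_distrib_left sum_distrib_right mult_scaleC_left mult_scaleC_right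
        clinear_sum[OF S] clinear_scale[OF S] mult.assoc)
  also have "\<dots> = (\<Sum>f\<in>E. S (x * f) * T (\<Sum>e\<in>E. \<psi> (star f * y * e) *\<^sub>C star e))"
    by (subst sum.swap) (simp add: sum_distrib_left mult_scaleC_right clinear_sum[OF T] clinear_scale[OF T])
  also have "\<dots> = (\<Sum>e\<in>E. S (x * e) * T (star e * y))"
    unfolding frame_expansion_right[symmetric] ..
  finally show ?thesis .
qed

lemma delta_form_iff:
  "delta_form \<psi> \<delta> \<longleftrightarrow> 0 \<le> \<delta> \<and> (\<forall>x. (\<Sum>e\<in>E. x * e * star e) = complex_of_real (\<delta>\<^sup>2) *\<^sub>C x)"
proof -
  have "mul (mul_adjoint \<psi> x) = (\<Sum>e\<in>E. x * e * star e)" for x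
    unfolding mul_def
    by (rule sum_mul_adjoint)
      (auto simp: clinear_iff distrib_left distrib_right mult_scaleC_left mult_scaleC_right)
  then show ?thesis by (simp add: delta_form_def)
qed

lemma delta_form_nonzero:
  assumes "delta_form \<psi> \<delta>" shows "\<delta> \<noteq> 0"
proof
  assume "\<delta> = 0"
  then have "(\<Sum>e\<in>E. e * star e) = 0" using assms[unfolded delta_form_iff] by (auto dest!: spec[of _ 1])
  then have "(\<Sum>e\<in>E. \<psi> (star e * e)) = 0"
    using trace by (metis (no_types, lifting) psi_sum psi_zero sum.cong)
  then have "(\<Sum>e\<in>E. Re (\<psi> (star e * e))) = 0" by (metis Re_sum zero_complex.simps(1))
  then have "\<forall>e\<in>E. Re (\<psi> (star e * e)) = 0"
    using sum_nonneg_eq_0_iff[OF finite_frame, of "\<lambda>e. Re (\<psi> (star e * e))"] faithful_stateD(4)[OF state] by auto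
  then have "\<forall>e\<in>E. e = 0"
    using faithful_stateD(3,5)[OF state] by (metis complex_is_Real_iff complex_eqI zero_complex.simps)
  then have "(\<Sum>e\<in>E. \<psi> (star e * 1) *\<^sub>C e) = 0" by (intro sum.neutral) auto
  then have "1 = (0 :: 'b)" unfolding frame_expansion[of 1, symmetric] .
  then show False by simp
qed

lemma delta_eq:
  assumes "delta_form \<psi> \<delta>" shows "delta \<psi> = \<delta>"
  unfolding delta_def
proof (rule the_equality)
  fix \<delta>' assume "delta_form \<psi> \<delta>'"
  then have "complex_of_real (\<delta>'\<^sup>2) *\<^sub>C (1 :: 'b) = complex_of_real (\<delta>\<^sup>2) *\<^sub>C 1" "0 \<le> \<delta>'" "0 \<le> \<delta>"
    using assms by (auto simp: delta_form_iff dest!: spec[of _ 1])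
  then show "\<delta>' = \<delta>" by (simp del: of_real_power)
qed fact

end

section \<open>The two-point space\<close>

definition pt :: "2 \<Rightarrow> complex ^ 2" where
  "pt i = axis i 1"

lemma pt_nth [simp]: "pt i $ j = (if i = j then 1 else 0)"
  by (auto simp: pt_def axis_def)

lemma scaleC_vec_nth [simp]: "(c *\<^sub>C x) $ i = c *\<^sub>C (x $ i)"
  and star_vec_nth [simp]: "star x $ i = star (x $ i)"
  by (simp_all add: scaleC_vec_def star_vec_def)

lemma pt_expansion: "x = x $ 1 *\<^sub>C pt 1 + x $ 2 *\<^sub>C pt 2"
  by (simp add: vec_eq_iff forall_2)

lemma pt_sum: "pt 1 + pt 2 = 1"
  by (simp add: vec_eq_iff forall_2)

lemma faithful_state_tau: "faithful_state tau"
proof -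
  have e: "tau (star x * x) = complex_of_real (((cmod (x $ 1))\<^sup>2 + (cmod (x $ 2))\<^sup>2) / 2)" for x
    using complex_norm_square[of "x $ 1"] complex_norm_square[of "x $ 2"]
    by (simp add: tau_def mult.commute)
  show ?thesis
    unfolding faithful_state_def
  proof (intro conjI allI impI)
    show "clinear tau" by (simp add: clinear_iff tau_def field_simps)
    show "tau 1 = 1" by (simp add: tau_def)
    fix x
    show "tau (star x * x) \<in> \<real>" "0 \<le> Re (tau (star x * x))" by (simp_all only: e Reals_of_real) simp
    assume "tau (star x * x) = 0"
    then have "((cmod (x $ 1))\<^sup>2 + (cmod (x $ 2))\<^sup>2) / 2 = 0" unfolding e of_real_eq_0_iff .
    then show "x = 0" by (simp add: vec_eq_iff forall_2 sum_power2_eq_zero_iff)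
  qed
qed

text \<open>The points have norm \<open>1 / sqrt 2\<close> for \<open>\<tau>\<close>.\<close>

definition tau_frame :: "(complex ^ 2) set" where
  "tau_frame = {complex_of_real (sqrt 2) *\<^sub>C pt 1, complex_of_real (sqrt 2) *\<^sub>C pt 2}"

lemma sqrt2_mult: "complex_of_real (sqrt 2) * (complex_of_real (sqrt 2) * z) = 2 * z"
  by (simp add: mult.assoc[symmetric] flip: of_real_mult)

lemma sum_tau_frame:
  "(\<Sum>e\<in>tau_frame. g e) = g (complex_of_real (sqrt 2) *\<^sub>C pt 1) + g (complex_of_real (sqrt 2) *\<^sub>C pt 2)"
  by (simp add: tau_frame_def vec_eq_iff forall_2)

interpretation tau: tracial_frame tau tau_frame
proof
  show "faithful_state tau" by (rule faithful_state_tau)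
  show "finite tau_frame" by (simp add: tau_frame_def)
  show "x = (\<Sum>e\<in>tau_frame. tau (star e * x) *\<^sub>C e)" for x
    unfolding sum_tau_frame
    by (simp add: vec_eq_iff forall_2 tau_def sqrt2_mult mult.commute[of _ "complex_of_real (sqrt 2)"]
        mult.left_commute)
  show "tau (x * y) = tau (y * x)" for x y by (simp add: mult.commute)
qed

lemma delta_tau: "(delta tau)\<^sup>2 = 2"
proof -
  have "delta_form tau (sqrt 2)"
    unfolding tau.delta_form_iff sum_tau_frame
    by (simp add: vec_eq_iff forall_2 sqrt2_mult mult.commute mult.left_commute)
  then show ?thesis by (simp add: tau.delta_eq)
qed

text \<open>In the basis of points the Schur product is the entrywise product of matrices, so the two
  Schur products by \<open>adj_T2\<close> and \<open>adj_K2\<close> erase the off-diagonal and the diagonal entries.\<close>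

lemma schur_tau:
  assumes S: "clinear S" and T: "clinear T"
  shows "schur tau S T x = x $ 1 *\<^sub>C (S (pt 1) * T (pt 1)) + x $ 2 *\<^sub>C (S (pt 2) * T (pt 2))"
proof -
  have 1: "x * complex_of_real (sqrt 2) *\<^sub>C pt i = (complex_of_real (sqrt 2) * x $ i) *\<^sub>C pt i" for i :: 2 and x
    by (auto simp: vec_eq_iff)
  have 2: "star (complex_of_real (sqrt 2) *\<^sub>C pt i) = complex_of_real (sqrt 2) *\<^sub>C pt i" for i :: 2
    by (auto simp: vec_eq_iff)
  show ?thesis
    unfolding tau.schur_eq_sum[OF S T] sum_tau_frame delta_tau 1 2
    by (simp add: clinear_scale[OF S] clinear_scale[OF T] scaleC_mult_simps scaleC_add_right
        mult.assoc sqrt2_mult mult.commute[of _ "complex_of_real (sqrt 2)"] mult.left_commute)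
qed

lemma clinear_T2: "clinear adj_T2"
  by (simp add: clinear_iff adj_T2_def)

lemma adj_K2_nth: "adj_K2 x $ 1 = x $ 2" "adj_K2 x $ 2 = x $ 1"
  by (simp_all add: adj_K2_def matrix_vector_mult_def sum_2)

lemma clinear_K2: "clinear adj_K2"
  by (simp add: clinear_iff vec_eq_iff forall_2 adj_K2_nth)

lemma clinear_eq_on_pt:
  assumes "clinear S" "clinear T"
  shows "S = T \<longleftrightarrow> S (pt 1) = T (pt 1) \<and> S (pt 2) = T (pt 2)"
proof (intro iffI ext)
  fix x :: "complex ^ 2"
  assume *: "S (pt 1) = T (pt 1) \<and> S (pt 2) = T (pt 2)"
  have "S (x $ 1 *\<^sub>C pt 1 + x $ 2 *\<^sub>C pt 2) = T (x $ 1 *\<^sub>C pt 1 + x $ 2 *\<^sub>C pt 2)"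
    using * by (simp add: clinear_add[OF assms(1)] clinear_add[OF assms(2)] clinear_scale[OF assms(1)]
      clinear_scale[OF assms(2)])
  then show "S x = T x" using pt_expansion[of x] by simp
qed simp

lemma clinear_schur_tau:
  assumes "clinear S" "clinear T" shows "clinear (schur tau S T)"
  by (simp add: clinear_iff schur_tau[OF assms] vec_eq_iff forall_2 algebra_simps)

lemma schur_T2_iff:
  assumes T: "clinear T"
  shows "schur tau adj_T2 T = T \<longleftrightarrow> T (pt 1) $ 2 = 0 \<and> T (pt 2) $ 1 = 0"
  unfolding clinear_eq_on_pt[OF clinear_schur_tau[OF clinear_T2 T] T] schur_tau[OF clinear_T2 T]
  by (auto simp: vec_eq_iff forall_2 adj_T2_def)

lemma schur_K2_iff:
  assumes T: "clinear T"
  shows "schur tau adj_K2 T = T \<longleftrightarrow> T (pt 1) $ 1 = 0 \<and> T (pt 2) $ 2 = 0"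
  unfolding clinear_eq_on_pt[OF clinear_schur_tau[OF clinear_K2 T] T] schur_tau[OF clinear_K2 T]
  by (auto simp: vec_eq_iff forall_2 adj_K2_nth)

lemma quantum_relation_K2:
  "quantum_relation tau adj_K2 = {T. clinear T \<and> (\<forall>i. T (pt i) $ i = 0)}" (is "_ = ?R")
proof (intro equalityI subsetI)
  fix R assume "R \<in> quantum_relation tau adj_K2"
  then obtain T where T: "clinear T" "R = schur tau adj_K2 T" by (auto simp: quantum_relation_def)
  then show "R \<in> ?R"
    using clinear_schur_tau[OF clinear_K2 T(1)]
    by (simp add: schur_tau[OF clinear_K2] forall_2 adj_K2_nth)
next
  fix R assume "R \<in> ?R"
  then show "R \<in> quantum_relation tau adj_K2"
    using schur_K2_iff[of R] by (auto simp: quantum_relation_def intro!: exI[of _ R])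
qed

section \<open>Homomorphisms to two-point graphs are projections\<close>

definition projection :: "'b::complex_star_algebra \<Rightarrow> bool" where
  "projection p \<longleftrightarrow> p * p = p \<and> star p = p"

lemma projection_compl: "projection p \<Longrightarrow> projection (1 - p)"
  by (simp add: projection_def algebra_simps star_diff)

text \<open>Homomorphisms out of \<open>\<complex>\<^sup>2\<close> are determined by the image \<open>p\<close> of the first point.\<close>

definition splitting :: "'b::complex_star_algebra \<Rightarrow> complex ^ 2 \<Rightarrow> 'b" where
  "splitting p v = v $ 1 *\<^sub>C p + v $ 2 *\<^sub>C (1 - p)"

lemma splitting_pt [simp]: "splitting p (pt 1) = p" "splitting p (pt 2) = 1 - p"
  by (simp_all add: splitting_def)

lemma splitting_star_hom:
  assumes "projection p" shows "unital_star_hom (splitting p)"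
proof -
  have p: "p * p = p" "star p = p" using assms by (auto simp: projection_def)
  have z: "p * (1 - p) = 0" "(1 - p) * p = 0" "(1 - p) * (1 - p) = 1 - p" by (simp_all add: algebra_simps p)
  show ?thesis
    unfolding unital_star_hom_def
    by (auto simp: clinear_iff splitting_def scaleC_add_left scaleC_add_right scaleC_scaleC scaleC_one
        distrib_left distrib_right mult_scaleC_left mult_scaleC_right z p star_simps mult.commute)
qed

lemma splitting_inj:
  assumes p: "projection p" "p \<noteq> 0" "p \<noteq> 1" shows "inj (splitting p)"
proof (rule injI)
  fix v w assume *: "splitting p v = splitting p w"
  have pp: "p * p = p" using p by (simp add: projection_def)
  have "p * splitting p u = u $ 1 *\<^sub>C p" "(1 - p) * splitting p u = u $ 2 *\<^sub>C (1 - p)" for u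
    by (simp_all add: splitting_def distrib_left mult_scaleC_right left_diff_distrib right_diff_distrib pp)
  then have "v $ 1 *\<^sub>C p = w $ 1 *\<^sub>C p" "v $ 2 *\<^sub>C (1 - p) = w $ 2 *\<^sub>C (1 - p)" using * by metis+
  then show "v = w" using p(2,3) by (simp add: vec_eq_iff forall_2)
qed

lemma unital_star_hom_splitting:
  assumes f: "unital_star_hom f"
  shows "f = splitting (f (pt 1))" "projection (f (pt 1))"
proof -
  have lin: "clinear f" and f1: "f 1 = 1" and fm: "\<And>x y. f (x * y) = f x * f y"
    and fs: "\<And>x. f (star x) = star (f x)" using f by (auto simp: unital_star_hom_def)
  have 2: "f (pt 2) = 1 - f (pt 1)"
    using clinear_add[OF lin, of "pt 1" "pt 2"] f1 by (simp add: pt_sum algebra_simps)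
  show "f = splitting (f (pt 1))"
  proof
    fix x
    have "f x = f (x $ 1 *\<^sub>C pt 1 + x $ 2 *\<^sub>C pt 2)" using pt_expansion[of x] by simp
    then show "f x = splitting (f (pt 1)) x"
      by (simp add: clinear_add[OF lin] clinear_scale[OF lin] splitting_def 2)
  qed
  have "pt 1 * pt 1 = pt 1" "star (pt 1) = pt 1" by (simp_all add: vec_eq_iff)
  then show "projection (f (pt 1))" using fm[of "pt 1" "pt 1"] fs[of "pt 1"] by (simp add: projection_def)
qed

lemma adjoint_tau:
  assumes st: "faithful_state \<psi>" and f: "clinear f"
  shows "clinear (adjoint_op tau \<psi> f)" "adjoint_op tau \<psi> f y $ i = 2 * \<psi> (star (f (pt i)) * y)"
proof -
  show "clinear (adjoint_op tau \<psi> f)" by (rule tau.adjoint_op[OF st f])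
  have "cnj (adjoint_op tau \<psi> f y $ i) / 2 = \<psi> (star y * f (pt i))"
    using tau.adjoint_op(2)[OF st f, of y "pt i"] exhaust_2[of i]
    by (auto simp: l2_inner_def tau_def)
  then have "cnj (adjoint_op tau \<psi> f y $ i) = 2 * \<psi> (star y * f (pt i))" by simp
  then have "cnj (cnj (adjoint_op tau \<psi> f y $ i)) = cnj (2 * \<psi> (star y * f (pt i)))" by (rule arg_cong)
  then show "adjoint_op tau \<psi> f y $ i = 2 * \<psi> (star (f (pt i)) * y)"
    by (simp add: state_star[OF st, symmetric] star_simps)
qed

text \<open>The matrix of \<open>f\<^sup>\<dagger> A f\<close> has the entries \<open>2 \<psi> (p\<^sub>i A p\<^sub>j)\<close>, where \<open>p\<^sub>1 = p\<close> and
  \<open>p\<^sub>2 = 1 - p\<close>.\<close>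

lemma
  assumes st: "faithful_state \<psi>" and A: "clinear A" and p: "projection p"
  shows graph_hom_T2_iff: "graph_hom \<psi> A tau adj_T2 (splitting p) \<longleftrightarrow>
      \<psi> (p * A (1 - p)) = 0 \<and> \<psi> ((1 - p) * A p) = 0"
    and graph_hom_K2_iff: "graph_hom \<psi> A tau adj_K2 (splitting p) \<longleftrightarrow>
      \<psi> (p * A p) = 0 \<and> \<psi> ((1 - p) * A (1 - p)) = 0"
proof -
  note h = splitting_star_hom[OF p]
  have lin: "clinear (splitting p)" using h by (simp add: unital_star_hom_def)
  have s: "star p = p" using p by (simp add: projection_def)
  let ?T = "adjoint_op tau \<psi> (splitting p) \<circ> A \<circ> splitting p"
  have T: "clinear ?T"
    using lin A adjoint_tau(1)[OF st lin] by (simp add: clinear_iff)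
  show "graph_hom \<psi> A tau adj_T2 (splitting p) \<longleftrightarrow>
      \<psi> (p * A (1 - p)) = 0 \<and> \<psi> ((1 - p) * A p) = 0"
    using h by (auto simp: graph_hom_def Let_def schur_T2_iff[OF T] adjoint_tau(2)[OF st lin] star_diff s)
  show "graph_hom \<psi> A tau adj_K2 (splitting p) \<longleftrightarrow>
      \<psi> (p * A p) = 0 \<and> \<psi> ((1 - p) * A (1 - p)) = 0"
    using h by (auto simp: graph_hom_def Let_def schur_K2_iff[OF T] adjoint_tau(2)[OF st lin] star_diff s)
qed

section \<open>Spectral projections of self-adjoint elements\<close>

definition peval :: "complex poly \<Rightarrow> 'b::complex_star_algebra \<Rightarrow> 'b" where
  "peval q h = fold_coeffs (\<lambda>a y. a *\<^sub>C 1 + h * y) q 0"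

lemma peval_0 [simp]: "peval 0 h = 0"
  by (simp add: peval_def)

lemma peval_pCons [simp]: "peval (pCons a q) h = a *\<^sub>C 1 + h * peval q h"
  by (cases "q = 0 \<and> a = 0") (auto simp: peval_def)

lemma peval_add: "peval (q + r) h = peval q h + peval r h"
  by (induction q r rule: poly_induct2) (simp_all add: scaleC_add_left algebra_simps)

lemma peval_smult: "peval (Polynomial.smult c q) h = c *\<^sub>C peval q h"
  by (induction q) (simp_all add: scaleC_add_right scaleC_scaleC mult_scaleC_right)

lemma peval_minus: "peval (- q) h = - peval q h"
  using peval_smult[of "-1" q h] by simp

lemma peval_diff: "peval (q - r) h = peval q h - peval r h"
  using peval_add[of q "- r" h] by (simp add: peval_minus)

lemma peval_mult: "peval (q * r) h = peval q h * peval r h"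
  by (induction q) (simp_all add: peval_add peval_smult mult_scaleC_left distrib_right mult.assoc)

lemma peval_sum: "peval (\<Sum>i\<in>I. g i) h = (\<Sum>i\<in>I. peval (g i) h)"
  by (induction I rule: infinite_finite_induct) (simp_all add: peval_add)

lemma peval_monom: "peval (monom c n) h = c *\<^sub>C h ^ n"
  by (induction n) (simp_all add: monom_0 monom_Suc mult_scaleC_right)

lemma peval_commute: "h * peval q h = peval q h * h"
proof (induction q)
  case (pCons a q)
  have "h * (h * peval q h) = h * (peval q h * h)" by (simp only: pCons.IH)
  also have "\<dots> = h * peval q h * h" by (simp only: mult.assoc)
  finally have "h * (h * peval q h) = h * peval q h * h" .
  then show ?case by (simp add: distrib_left distrib_right mult_scaleC_right mult_scaleC_left)
qed simp

lemma star_peval: "star h = h \<Longrightarrow> star (peval q h) = peval (map_poly cnj q) h"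
  by (induction q) (simp_all add: map_poly_pCons star_simps peval_commute)

context parseval_frame
begin

lemma span_frame: "cvs.span E = UNIV"
proof -
  have "x \<in> cvs.span E" for x
    by (subst frame_expansion[of x]) (intro cvs.span_sum cvs.span_scale cvs.span_base)
  then show ?thesis by blast
qed

lemma finite_dimensional: "\<exists>B. finite_dimensional_vector_space ((*\<^sub>C) :: complex \<Rightarrow> 'b \<Rightarrow> 'b) B"
proof -
  obtain B where B: "B \<subseteq> E" "cvs.independent B" "E \<subseteq> cvs.span B"
    using cvs.maximal_independent_subset by blast
  then have "cvs.span B = UNIV" using span_frame cvs.span_minimal[OF B(3) cvs.subspace_span] by auto
  then have "finite_dimensional_vector_space ((*\<^sub>C) :: complex \<Rightarrow> 'b \<Rightarrow> 'b) B"
    using B finite_subset[OF B(1) finite_frame] by unfold_locales auto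
  then show ?thesis by blast
qed

text \<open>More powers of \<open>h\<close> than the dimension of the algebra either repeat or are linearly
  dependent.\<close>

lemma annihilating_poly:
  fixes h :: 'b
  shows "\<exists>q. q \<noteq> 0 \<and> peval q h = 0"
proof (cases "inj_on (\<lambda>i. h ^ i) {..card E}")
  case False
  then obtain i j where ij: "i \<noteq> j" "h ^ i = h ^ j" by (auto simp: inj_on_def)
  have "coeff (monom 1 i - monom 1 j :: complex poly) i \<noteq> 0" using ij(1) by simp
  moreover have "peval (monom 1 i - monom 1 j) h = 0"
    by (simp add: peval_diff peval_monom ij)
  ultimately show ?thesis by (metis coeff_0)
next
  case True
  let ?H = "(\<lambda>i. h ^ i) ` {..card E}"
  have "card ?H = card E + 1" using True by (simp add: card_image)
  then have "cvs.dependent ?H"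
    using cvs.independent_span_bound[of E ?H] finite_frame span_frame by auto
  then obtain u where u: "\<exists>v\<in>?H. u v \<noteq> 0" "(\<Sum>v\<in>?H. u v *\<^sub>C v) = 0"
    using cvs.dependent_finite[of ?H] by auto
  define q where "q = (\<Sum>i\<le>card E. monom (u (h ^ i)) i)"
  have "peval q h = (\<Sum>v\<in>?H. u v *\<^sub>C v)"
    by (simp add: q_def peval_sum peval_monom sum.reindex[OF True])
  moreover have "q \<noteq> 0"
  proof -
    obtain i where i: "i \<le> card E" "u (h ^ i) \<noteq> 0" using u(1) by auto
    have "coeff q i = (\<Sum>j\<le>card E. if j = i then u (h ^ j) else 0)"
      by (simp add: q_def coeff_sum)
    also have "\<dots> = u (h ^ i)" using i(1) by simp
    finally show ?thesis using i(2) by auto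
  qed
  ultimately show ?thesis using u(2) by auto
qed

text \<open>A root \<open>\<lambda>\<close> of an annihilating polynomial \<open>(X - \<lambda>) r\<close> of least degree gives an
  element \<open>v = r(h) \<noteq> 0\<close> on which \<open>h\<close> acts as \<open>\<lambda>\<close>. Every polynomial in \<open>h\<close>, in particular
  \<open>w = v\<^sup>* v\<close> itself, then acts on \<open>w\<close> as a scalar, so a multiple of \<open>w\<close> is a projection;
  if it were \<open>1\<close>, then \<open>h\<close> would be the scalar \<open>\<lambda>\<close>.\<close>

lemma spectral_projection:
  fixes h :: 'b
  assumes h: "star h = h" and ns: "\<And>c. h \<noteq> c *\<^sub>C 1"
  shows "\<exists>q. projection (peval q h) \<and> peval q h \<noteq> 0 \<and> peval q h \<noteq> 1"
proof -
  obtain q where q: "q \<noteq> 0" "peval q h = 0"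
    and least: "\<And>r. r \<noteq> 0 \<Longrightarrow> peval r h = 0 \<Longrightarrow> degree q \<le> degree r"
    using ex_has_least_nat[of "\<lambda>q. q \<noteq> 0 \<and> peval q h = 0" _ degree] annihilating_poly[of h] by blast
  have "degree q \<noteq> 0"
  proof
    assume "degree q = 0"
    then obtain c where "q = [:c:]" by (meson degree_eq_zeroE)
    then show False using q by simp
  qed
  then obtain l where "poly q l = 0"
    using fundamental_theorem_of_algebra[of q] constant_degree[of q] by auto
  then obtain r where r: "q = [:- l, 1:] * r" by (auto simp: poly_eq_0_iff_dvd)
  have r0: "r \<noteq> 0" using q r by auto
  define v where "v = peval r h"
  have "degree q = Suc (degree r)" using r0 by (simp add: r degree_mult_eq del: mult_pCons_left)
  then have v0: "v \<noteq> 0" using least[of r] r0 by (auto simp: v_def)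
  have hv: "h * v = l *\<^sub>C v"
  proof -
    have "peval q h = h * v - l *\<^sub>C v"
      by (simp only: r peval_mult v_def[symmetric]) (simp add: algebra_simps mult_scaleC_left)
    then show ?thesis using q by simp
  qed
  define s where "s = map_poly cnj r * r"
  define w where "w = peval s h"
  have w: "w = star v * v" by (simp add: w_def s_def peval_mult v_def star_peval[OF h])
  have w0: "w \<noteq> 0" using v0 faithful_stateD(5)[OF state, of v] psi_zero by (auto simp: w)
  have ws: "star w = w" by (simp add: w star_simps)
  have hw: "h * w = l *\<^sub>C w"
  proof -
    have "star v = peval (map_poly cnj r) h" by (simp add: v_def star_peval[OF h])
    then have "h * w = star v * (h * v)" by (simp add: w mult.assoc[symmetric] peval_commute)
    then show ?thesis by (simp add: hv w mult_scaleC_right)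
  qed
  have act: "peval t h * w = poly t l *\<^sub>C w" for t
    by (induction t)
      (simp_all add: distrib_right mult_scaleC_left mult_scaleC_right mult.assoc hw scaleC_add_left
        scaleC_scaleC mult.commute)
  define c where "c = poly s l"
  have ww: "w * w = c *\<^sub>C w" using act[of s] by (simp add: w_def c_def)
  have c0: "c \<noteq> 0"
    using w0 ws ww faithful_stateD(5)[OF state, of w] psi_zero by auto
  have cr: "cnj c = c"
  proof -
    have "c *\<^sub>C w = cnj c *\<^sub>C w" by (metis star_mult star_scaleC ws ww)
    then show ?thesis using w0 by simp
  qed
  define p where "p = (1 / c) *\<^sub>C w"
  have "p = peval (Polynomial.smult (1 / c) s) h" by (simp add: p_def w_def peval_smult)
  moreover have "projection p"
    using c0 by (simp add: projection_def p_def scaleC_mult_simps ww star_simps ws cr)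
  moreover have "p \<noteq> 0" using c0 w0 by (simp add: p_def)
  moreover have "p \<noteq> 1"
  proof
    assume "p = 1"
    moreover have "h * p = l *\<^sub>C p" by (simp add: p_def mult_scaleC_right hw scaleC_scaleC)
    ultimately show False using ns[of l] by simp
  qed
  ultimately show ?thesis by metis
qed

end

section \<open>Undirected regular tracial graphs\<close>

locale regular_graph = tracial_frame \<psi> E
  for \<psi> :: "'b::complex_star_algebra \<Rightarrow> complex" and E +
  fixes A :: "'b \<Rightarrow> 'b" and d :: complex
  assumes linear_A: "clinear A"
    and schur_idempotent: "schur \<psi> A A = A"
    and delta_nonzero: "delta \<psi> \<noteq> 0"
    and A_star: "A (star x) = star (A x)"
    and A_symmetric: "\<psi> (x * A y) = \<psi> (A x * y)"
    and A_one: "A 1 = d *\<^sub>C 1"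
begin

lemmas A_add = clinear_add[OF linear_A] and A_scale = clinear_scale[OF linear_A]
  and A_diff = clinear_diff[OF linear_A]
  and A_sum = clinear_sum[OF linear_A] and A_zero = clinear_zero[OF linear_A]

lemma degree_real: "cnj d = d"
proof -
  have "d *\<^sub>C (1 :: 'b) = cnj d *\<^sub>C 1" using A_star[of 1] by (simp add: A_one star_simps)
  then show ?thesis by simp
qed

lemma psi_A: "\<psi> (A x) = d * \<psi> x"
  using A_symmetric[of 1 x] by (simp add: A_one mult_scaleC_left psi_scale)

text \<open>Schur idempotence, spread over a product by the bimodule property of \<open>m\<^sup>\<dagger>\<close>. As \<open>A\<close> is
  real, the case \<open>y = x\<^sup>*\<close> writes \<open>A (x x\<^sup>*)\<close> as a sum of positive elements.\<close>

lemma sum_A_A: "(\<Sum>e\<in>E. A (x * e) * A (star e * y)) = complex_of_real ((delta \<psi>)\<^sup>2) *\<^sub>C A (x * y)"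
proof -
  have "A (x * y) = complex_of_real (1 / (delta \<psi>)\<^sup>2) *\<^sub>C (\<Sum>e\<in>E. A (x * y * e) * A (star e))"
    using schur_eq_sum[OF linear_A linear_A, of "x * y"] by (simp add: schur_idempotent)
  then show ?thesis
    using delta_nonzero
    by (simp add: frame_bimodule[OF linear_A linear_A] scaleC_scaleC scaleC_one power2_eq_square)
qed

text \<open>Each term is \<open>\<ge> 0\<close>, because a positive trace is also positive on the elements \<open>y y\<^sup>*\<close>.\<close>

lemma frame_terms_zero:
  assumes "(\<Sum>e\<in>E. \<psi> (g e * star (g e))) = 0" and "e \<in> E"
  shows "g e = 0"
proof -
  have "(\<Sum>e\<in>E. Re (\<psi> (star (g e) * g e))) = Re (\<Sum>e\<in>E. \<psi> (g e * star (g e)))"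
    by (simp add: trace[of "g _" "star (g _)"])
  then have "Re (\<psi> (star (g e) * g e)) = 0"
    using assms sum_nonneg_eq_0_iff[OF finite_frame, of "\<lambda>e. Re (\<psi> (star (g e) * g e))"]
      faithful_stateD(4)[OF state] by auto
  moreover have "Im (\<psi> (star (g e) * g e)) = 0"
    using faithful_stateD(3)[OF state] by (simp add: complex_is_Real_iff)
  ultimately have "\<psi> (star (g e) * g e) = 0" by (simp add: complex_eq_iff)
  then show ?thesis using faithful_stateD(5)[OF state] by blast
qed

lemma clinear_zero_on_frame:
  assumes "clinear T" "\<And>e. e \<in> E \<Longrightarrow> T e = 0" shows "T b = 0"
proof -
  have "T (\<Sum>e\<in>E. \<psi> (star e * b) *\<^sub>C e) = 0"
    by (simp add: clinear_sum[OF assms(1)] clinear_scale[OF assms(1)] assms(2))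
  then show ?thesis using frame_expansion[of b] by simp
qed

text \<open>If no weight of \<open>A\<close> connects \<open>q\<close> to \<open>p\<close>, then the whole block of \<open>A\<close> from \<open>q\<close> to
  \<open>p\<close> vanishes, because the weight is a sum of squares of the entries of the block.\<close>

lemma zero_block:
  assumes p: "projection p" and q: "projection q" and z: "\<psi> (p * A q) = 0"
  shows "p * A (q * b) = 0"
proof (rule clinear_zero_on_frame[of "\<lambda>b. p * A (q * b)"])
  show "clinear (\<lambda>b. p * A (q * b))"
    by (simp add: clinear_iff distrib_left A_add A_scale mult_scaleC_right)
  fix e assume "e \<in> E"
  have pp: "p * p = p" "star p = p" and qq: "q * q = q" "star q = q"
    using p q by (auto simp: projection_def)
  have "(\<Sum>e\<in>E. \<psi> (p * A (q * e) * star (p * A (q * e))))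
      = \<psi> (p * (\<Sum>e\<in>E. A (q * e) * A (star e * q)) * p)"
    by (simp add: star_simps pp qq A_star[symmetric] sum_distrib_left sum_distrib_right psi_sum mult.assoc)
  also have "\<dots> = complex_of_real ((delta \<psi>)\<^sup>2) * \<psi> (p * A q * p)"
    by (simp add: sum_A_A qq mult_scaleC_left mult_scaleC_right psi_scale)
  also have "\<psi> (p * A q * p) = \<psi> (p * A q)"
    using trace[of "p * A q" p] by (simp add: pp mult.assoc[symmetric])
  finally show "p * A (q * e) = 0"
    using frame_terms_zero[of "\<lambda>e. p * A (q * e)"] z \<open>e \<in> E\<close> by simp
qed

lemma degree_zero: "d = 0 \<Longrightarrow> A x = 0"
  using zero_block[of 1 1 x] by (simp add: projection_def A_one psi_zero)

text \<open>By \<open>zero_block\<close> the two vanishing weights say that \<open>A\<close> maps the right ideal \<open>p B\<close> into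
  \<open>(1 - p) B\<close> and vice versa. The second form puts this into one equation, from which it is plain
  that \<open>p - (1 - p)\<close> anticommutes with \<open>A\<close>.\<close>

lemma bipartition_iff:
  assumes p: "projection p"
  shows "\<psi> (p * A p) = 0 \<and> \<psi> ((1 - p) * A (1 - p)) = 0 \<longleftrightarrow> (\<forall>b. A (p * b) = (1 - p) * A b)"
    (is "?l \<longleftrightarrow> ?r")
proof
  have pp: "p * p = p" using p by (simp add: projection_def)
  { assume l: ?l
    show ?r
    proof
      fix b
      have 1: "p * A (p * b) = 0" and 2: "(1 - p) * A ((1 - p) * b) = 0"
        using zero_block[OF p p] zero_block[OF projection_compl[OF p] projection_compl[OF p]] l by auto
      have "A (p * b) - (1 - p) * A b = p * A (p * b) - (1 - p) * A ((1 - p) * b)"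
        by (simp add: algebra_simps A_diff)
      then show "A (p * b) = (1 - p) * A b" using 1 2 by simp
    qed }
  assume r: ?r
  have "A p = (1 - p) * A 1" using r[rule_format, of 1] by simp
  moreover have "p * (1 - p) = 0" by (simp add: algebra_simps pp)
  ultimately have "p * A p = 0" "(1 - p) * A (1 - p) = 0"
    by (simp_all add: A_diff mult.assoc[symmetric]) (simp add: algebra_simps pp A_one mult_scaleC_right)
  then show ?l by (simp add: psi_zero)
qed

text \<open>The equality case of the Cauchy--Schwarz inequality: expanding with \<open>sum_A_A\<close>, the sum
  over the frame of \<open>\<parallel>A (x e) + x (A e)\<parallel>\<^sup>2\<close> is \<open>\<delta>\<^sup>2 (d - d - d + d) \<psi> (x\<^sup>2) = 0\<close>.\<close>

lemma extremal_eigenvector_anticommutes: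
  assumes x: "star x = x" and ev: "A x = (- d) *\<^sub>C x"
  shows "A (x * b) = - (x * A b)"
proof -
  have "A (x * b) + x * A b = 0"
  proof (rule clinear_zero_on_frame[of "\<lambda>b. A (x * b) + x * A b"])
    show "clinear (\<lambda>b. A (x * b) + x * A b)"
      by (simp add: clinear_iff distrib_left A_add A_scale mult_scaleC_right scaleC_add_right)
    fix e assume e: "e \<in> E"
    let ?g = "\<lambda>e. A (x * e) + x * A e"
    let ?D = "complex_of_real ((delta \<psi>)\<^sup>2)"
    have g: "?g e * star (?g e) = A (x * e) * A (star e * x) + A (x * e) * A (star e * 1) * x
        + x * (A (1 * e) * A (star e * x)) + x * (A (1 * e) * A (star e * 1)) * x" for e
      using A_star[of "x * e"] A_star[of e] by (simp add: star_simps x algebra_simps)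
    have "(\<Sum>e\<in>E. ?g e * star (?g e)) = ?D *\<^sub>C (A (x * x) + A x * x + x * A x + x * A 1 * x)"
      unfolding g sum.distrib sum_distrib_left[symmetric] sum_distrib_right[symmetric] sum_A_A
      by (simp add: scaleC_add_right mult_scaleC_left mult_scaleC_right)
    moreover have "\<psi> (A (x * x) + A x * x + x * A x + x * A 1 * x) = 0"
      by (simp add: psi_add psi_diff psi_A ev A_one mult_scaleC_left mult_scaleC_right psi_scale
          clinear_minus[OF lin])
    ultimately have "(\<Sum>e\<in>E. \<psi> (?g e * star (?g e))) = 0"
      by (simp only: psi_sum[symmetric] psi_scale scaleC_complex mult_zero_right)
    then show "?g e = 0" using frame_terms_zero[of ?g, OF _ e] by blast
  qed
  then show ?thesis by (simp add: eq_neg_iff_add_eq_0)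
qed

text \<open>A projection that commutes with \<open>A\<close> cuts the graph into two parts without edges between
  them, which is a homomorphism to \<open>T\<^sub>2\<close>.\<close>

lemma connected_commuting_projection:
  assumes con: "connected_graph \<psi> A" and p: "projection p" and c: "\<And>b. A (p * b) = p * A b"
  shows "p = 0 \<or> p = 1"
proof (rule ccontr)
  assume "\<not> (p = 0 \<or> p = 1)"
  then have inj: "inj (splitting p)" using splitting_inj[OF p] by blast
  have pp: "p * p = p" using p by (simp add: projection_def)
  have Ap: "A p = d *\<^sub>C p" using c[of 1] by (simp add: A_one mult_scaleC_right)
  have "\<psi> (p * A (1 - p)) = 0 \<and> \<psi> ((1 - p) * A p) = 0"
    by (simp add: A_diff A_one Ap algebra_simps mult_scaleC_right pp psi_zero)
  then have "graph_hom \<psi> A tau adj_T2 (splitting p)"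
    using graph_hom_T2_iff[OF state linear_A p] by blast
  then show False using con inj by (auto simp: connected_graph_def surjective_graph_hom_def)
qed

lemma connected_commuting_scalar:
  assumes con: "connected_graph \<psi> A" and h: "star h = h" and c: "\<And>b. A (h * b) = h * A b"
  shows "\<exists>c. h = c *\<^sub>C 1"
proof (rule ccontr)
  assume "\<nexists>c. h = c *\<^sub>C 1"
  then obtain q where q: "projection (peval q h)" "peval q h \<noteq> 0" "peval q h \<noteq> 1"
    using spectral_projection[OF h] by blast
  have "A (peval q h * b) = peval q h * A b" for b
    by (induction q)
      (simp_all add: A_zero A_add A_scale distrib_right mult_scaleC_left mult.assoc c)
  then show False using connected_commuting_projection[OF con q(1)] q by blast
qed

text \<open>Since \<open>x\<close> anticommutes with \<open>A\<close>, its square commutes with \<open>A\<close> and is a scalar by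
  connectedness. A rescaling makes \<open>x\<close> a symmetry, \<open>u\<^sup>2 = 1\<close>, and \<open>p = (1 + u) / 2\<close> is one side
  of a bipartition. It has \<open>\<psi> p = 1 / 2\<close>, which rules out \<open>p = 0\<close> and \<open>p = 1\<close>.\<close>

lemma bipartition_of_self_adjoint_eigenvector:
  assumes con: "connected_graph \<psi> A"
    and x: "star x = x" "x \<noteq> 0" "A x = (- d) *\<^sub>C x" "\<psi> x = 0"
  shows "\<exists>p. projection p \<and> p \<noteq> 0 \<and> p \<noteq> 1 \<and> (\<forall>b. A (p * b) = (1 - p) * A b)"
proof -
  note anti = extremal_eigenvector_anticommutes[OF x(1,3)]
  obtain c where c: "x * x = c *\<^sub>C 1"
    using connected_commuting_scalar[OF con, of "x * x"] by (auto simp: star_simps x(1) mult.assoc anti)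
  have "\<psi> (x * x) = c" using faithful_stateD(2)[OF state] by (simp add: c psi_scale)
  then have cr: "c \<in> \<real>" "0 \<le> Re c" "c \<noteq> 0"
    using faithful_stateD(3-5)[OF state, of x] x(1,2) by auto
  define r where "r = sqrt (Re c)"
  have r0: "r \<noteq> 0" "complex_of_real r * complex_of_real r = c"
    using cr by (auto simp: r_def complex_is_Real_iff complex_eq_iff)
  define u where "u = complex_of_real (1 / r) *\<^sub>C x"
  have u: "u * u = 1" "star u = u" "\<psi> u = 0"
    using r0 by (auto simp: u_def scaleC_mult_simps c star_simps x psi_scale scaleC_one divide_simps)
  have u_anti: "A (u * b) = - (u * A b)" for b
    by (simp add: u_def mult_scaleC_left A_scale anti)
  define p where "p = (1 / 2) *\<^sub>C (1 + u)"
  have half: "(1 / 2) *\<^sub>C y + (1 / 2) *\<^sub>C y = y" for y :: 'b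
    by (simp add: scaleC_add_left[symmetric] scaleC_one)
  have compl: "1 - p = (1 / 2) *\<^sub>C (1 - u)"
    using half[of 1] by (simp add: p_def scaleC_add_right cvs.scale_right_diff_distrib algebra_simps)
  have "projection p"
  proof -
    have "(1 + u) * (1 + u) = (1 + u) + (1 + u)" by (simp add: algebra_simps u)
    moreover have "p * p = (1 / 2) *\<^sub>C (1 / 2) *\<^sub>C ((1 + u) * (1 + u))"
      unfolding p_def by (simp only: mult_scaleC_left mult_scaleC_right)
    ultimately have "p * p = (1 / 2) *\<^sub>C p + (1 / 2) *\<^sub>C p"
      unfolding p_def by (simp only: scaleC_add_right)
    then have "p * p = p" by (simp only: half)
    then show ?thesis by (simp add: projection_def) (simp add: p_def star_simps u)
  qed
  moreover have "\<psi> p = 1 / 2" using faithful_stateD(2)[OF state] by (simp add: p_def psi_scale psi_add u)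
  then have "p \<noteq> 0" "p \<noteq> 1" using faithful_stateD(2)[OF state] psi_zero by auto
  moreover have "A (p * b) = (1 - p) * A b" for b
    unfolding compl by (simp add: p_def mult_scaleC_left distrib_right left_diff_distrib A_scale A_add u_anti)
  ultimately show ?thesis by blast
qed

text \<open>The real and imaginary parts of an eigenvector for a real eigenvalue are again
  eigenvectors, as \<open>A\<close> is real.\<close>

lemma bipartition_of_eigenvector:
  assumes con: "connected_graph \<psi> A" and y: "y \<noteq> 0" "A y = (- d) *\<^sub>C y" "\<psi> y = 0"
  shows "\<exists>p. projection p \<and> p \<noteq> 0 \<and> p \<noteq> 1 \<and> (\<forall>b. A (p * b) = (1 - p) * A b)"
proof -
  have ys: "A (star y) = (- d) *\<^sub>C star y" "\<psi> (star y) = 0"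
    using y(2,3) degree_real by (simp_all add: A_star star_simps state_star[OF state])
  show ?thesis
  proof (cases "y + star y = 0")
    case False
    then show ?thesis
      using ys y by (intro bipartition_of_self_adjoint_eigenvector[OF con, of "y + star y"])
        (simp_all add: star_simps A_add psi_add scaleC_add_right add.commute)
  next
    case True
    then have s: "star y = - y" by (simp add: eq_neg_iff_add_eq_0 add.commute)
    show ?thesis
      using y s by (intro bipartition_of_self_adjoint_eigenvector[OF con, of "\<i> *\<^sub>C y"])
        (simp_all add: star_simps A_scale psi_scale scaleC_scaleC mult.commute)
  qed
qed

lemma spec_iff: "c \<in> spec A \<longleftrightarrow> (\<exists>x. x \<noteq> 0 \<and> A x = c *\<^sub>C x)"
proof -
  let ?T = "\<lambda>x. A x - c *\<^sub>C x"
  have T: "clinear ?T"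
    by (simp add: clinear_iff A_add A_scale scaleC_add_right cvs.scale_right_diff_distrib scaleC_scaleC
        mult.commute)
  obtain B where "finite_dimensional_vector_space ((*\<^sub>C) :: complex \<Rightarrow> 'b \<Rightarrow> 'b) B"
    using finite_dimensional by blast
  then have "bij ?T \<longleftrightarrow> inj ?T"
    using finite_dimensional_vector_space.linear_inj_imp_surj[OF _ T] by (auto simp: bij_def)
  also have "\<dots> \<longleftrightarrow> (\<forall>x. ?T x = 0 \<longrightarrow> x = 0)"
    using clinear_diff[OF T] clinear_zero[OF T] unfolding inj_def by (metis eq_iff_diff_eq_0)
  finally show ?thesis by (auto simp: spec_def)
qed

text \<open>The kernel of \<open>\<psi>\<close> is a complement of the scalars. In degree \<open>0\<close>, where the eigenspace of
  \<open>- d\<close> is the whole algebra, this supplies an eigenvector orthogonal to \<open>1\<close>.\<close>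

lemma dim_ge_2_iff: "cdim (UNIV :: 'b set) \<ge> 2 \<longleftrightarrow> (\<exists>y. y \<noteq> 0 \<and> \<psi> y = 0)"
proof
  assume dim: "cdim (UNIV :: 'b set) \<ge> 2"
  show "\<exists>y. y \<noteq> 0 \<and> \<psi> y = 0"
  proof (rule ccontr)
    assume none: "\<nexists>y. y \<noteq> 0 \<and> \<psi> y = 0"
    have "x \<in> cvs.span {1}" for x :: 'b
    proof -
      have "\<psi> (x - \<psi> x *\<^sub>C 1) = 0" using faithful_stateD(2)[OF state] by (simp add: psi_diff psi_scale)
      then have "x = \<psi> x *\<^sub>C 1" using none by (metis eq_iff_diff_eq_0)
      then show ?thesis unfolding cvs.span_singleton by blast
    qed
    then have "cdim (UNIV :: 'b set) \<le> card {1 :: 'b}" by (intro cvs.dim_le_card) auto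
    then show False using dim by simp
  qed
next
  assume "\<exists>y. y \<noteq> 0 \<and> \<psi> y = 0"
  then obtain y where y: "y \<noteq> 0" "\<psi> y = 0" by blast
  obtain B where "finite_dimensional_vector_space ((*\<^sub>C) :: complex \<Rightarrow> 'b \<Rightarrow> 'b) B"
    using finite_dimensional by blast
  then interpret fd: finite_dimensional_vector_space "(*\<^sub>C) :: complex \<Rightarrow> 'b \<Rightarrow> 'b" B .
  have ne: "y \<noteq> c *\<^sub>C 1" for c
    using y faithful_stateD(2)[OF state] by (auto simp: psi_scale)
  have "y \<notin> cvs.span {1}" using ne by (auto simp: cvs.span_singleton)
  then have "cvs.independent {y, 1}" using cvs.independent_insertI[of y "{1}"] by simp
  then have "card {y, 1} \<le> cdim (UNIV :: 'b set)" by (intro fd.independent_card_le_dim) auto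
  then show "cdim (UNIV :: 'b set) \<ge> 2" using ne[of 1] by (simp add: scaleC_one)
qed

end

section \<open>Color algebras and their linear forms\<close>

text \<open>The axioms of a color algebra, with the scalars ranging over all complex numbers instead of
  the carrier of \<open>complex_ring\<close>.\<close>

lemma unital_star_algebraD:
  fixes \<A> :: "'u star_algebra" (structure)
  assumes U: "unital_star_algebra \<A>"
  shows "\<one> \<in> carrier \<A>" "\<zero> \<in> carrier \<A>"
    and "a \<in> carrier \<A> \<Longrightarrow> b \<in> carrier \<A> \<Longrightarrow> a \<oplus> b \<in> carrier \<A>"
    and "a \<in> carrier \<A> \<Longrightarrow> b \<in> carrier \<A> \<Longrightarrow> a \<otimes> b \<in> carrier \<A>"
    and "a \<in> carrier \<A> \<Longrightarrow> c \<odot> a \<in> carrier \<A>"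
    and "a \<in> carrier \<A> \<Longrightarrow> \<one> \<otimes> a = a" "a \<in> carrier \<A> \<Longrightarrow> a \<otimes> \<one> = a"
    and "a \<in> carrier \<A> \<Longrightarrow> b \<in> carrier \<A> \<Longrightarrow> x \<in> carrier \<A> \<Longrightarrow> (a \<oplus> b) \<otimes> x = a \<otimes> x \<oplus> b \<otimes> x"
    and "a \<in> carrier \<A> \<Longrightarrow> b \<in> carrier \<A> \<Longrightarrow> x \<in> carrier \<A> \<Longrightarrow> x \<otimes> (a \<oplus> b) = x \<otimes> a \<oplus> x \<otimes> b"
    and "a \<in> carrier \<A> \<Longrightarrow> b \<in> carrier \<A> \<Longrightarrow> c \<odot> (a \<oplus> b) = c \<odot> a \<oplus> c \<odot> b"
    and "a \<in> carrier \<A> \<Longrightarrow> (c + c') \<odot> a = c \<odot> a \<oplus> c' \<odot> a"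
    and "a \<in> carrier \<A> \<Longrightarrow> (c * c') \<odot> a = c \<odot> (c' \<odot> a)"
    and "a \<in> carrier \<A> \<Longrightarrow> 1 \<odot> a = a"
    and "a \<in> carrier \<A> \<Longrightarrow> 0 \<odot> a = \<zero>"
    and "c \<odot> \<zero> = \<zero>"
    and "a \<in> carrier \<A> \<Longrightarrow> \<zero> \<oplus> a = a" "a \<in> carrier \<A> \<Longrightarrow> a \<oplus> \<zero> = a"
    and "a \<in> carrier \<A> \<Longrightarrow> b \<in> carrier \<A> \<Longrightarrow> a \<oplus> b = b \<oplus> a"
    and "a \<in> carrier \<A> \<Longrightarrow> b \<in> carrier \<A> \<Longrightarrow> x \<in> carrier \<A> \<Longrightarrow> (a \<oplus> b) \<oplus> x = a \<oplus> (b \<oplus> x)"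
    and "a \<in> carrier \<A> \<Longrightarrow> b \<in> carrier \<A> \<Longrightarrow> x \<in> carrier \<A> \<Longrightarrow> a \<oplus> (b \<oplus> x) = b \<oplus> (a \<oplus> x)"
    and "a \<in> carrier \<A> \<Longrightarrow> invol \<A> a \<in> carrier \<A>"
proof -
  interpret R: ring \<A> by (rule unital_star_algebra.axioms(1)[OF U])
  interpret M: Module.module complex_ring \<A> by (rule unital_star_algebra.axioms(2)[OF U])
  have c: "x \<in> carrier complex_ring" "add complex_ring = (+)" "mult complex_ring = (*)"
    "one complex_ring = 1" "zero complex_ring = 0" for x by (simp_all add: complex_ring_def)
  show "\<one> \<in> carrier \<A>" "\<zero> \<in> carrier \<A>"
    and "a \<in> carrier \<A> \<Longrightarrow> b \<in> carrier \<A> \<Longrightarrow> a \<oplus> b \<in> carrier \<A>"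
    and "a \<in> carrier \<A> \<Longrightarrow> b \<in> carrier \<A> \<Longrightarrow> a \<otimes> b \<in> carrier \<A>"
    and "a \<in> carrier \<A> \<Longrightarrow> c \<odot> a \<in> carrier \<A>"
    and "a \<in> carrier \<A> \<Longrightarrow> \<one> \<otimes> a = a" "a \<in> carrier \<A> \<Longrightarrow> a \<otimes> \<one> = a"
    by (simp_all add: c)
  show "a \<in> carrier \<A> \<Longrightarrow> b \<in> carrier \<A> \<Longrightarrow> x \<in> carrier \<A> \<Longrightarrow> (a \<oplus> b) \<otimes> x = a \<otimes> x \<oplus> b \<otimes> x"
    and "a \<in> carrier \<A> \<Longrightarrow> b \<in> carrier \<A> \<Longrightarrow> x \<in> carrier \<A> \<Longrightarrow> x \<otimes> (a \<oplus> b) = x \<otimes> a \<oplus> x \<otimes> b"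
    by (simp_all add: R.l_distr R.r_distr)
  show "a \<in> carrier \<A> \<Longrightarrow> b \<in> carrier \<A> \<Longrightarrow> c \<odot> (a \<oplus> b) = c \<odot> a \<oplus> c \<odot> b"
    and "a \<in> carrier \<A> \<Longrightarrow> (c + c') \<odot> a = c \<odot> a \<oplus> c' \<odot> a"
    and "a \<in> carrier \<A> \<Longrightarrow> (c * c') \<odot> a = c \<odot> (c' \<odot> a)"
    and "a \<in> carrier \<A> \<Longrightarrow> 1 \<odot> a = a"
    and "a \<in> carrier \<A> \<Longrightarrow> 0 \<odot> a = \<zero>"
    and "c \<odot> \<zero> = \<zero>"
    using M.smult_r_distr[of c a b] M.smult_l_distr[of c c' a] M.smult_assoc1[of c c' a] M.smult_one[of a]
      M.smult_l_null[of a] M.smult_r_null[of c]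
    by (simp_all add: c)
  show "a \<in> carrier \<A> \<Longrightarrow> \<zero> \<oplus> a = a" "a \<in> carrier \<A> \<Longrightarrow> a \<oplus> \<zero> = a"
    and "a \<in> carrier \<A> \<Longrightarrow> b \<in> carrier \<A> \<Longrightarrow> a \<oplus> b = b \<oplus> a"
    and "a \<in> carrier \<A> \<Longrightarrow> b \<in> carrier \<A> \<Longrightarrow> x \<in> carrier \<A> \<Longrightarrow> (a \<oplus> b) \<oplus> x = a \<oplus> (b \<oplus> x)"
    and "a \<in> carrier \<A> \<Longrightarrow> b \<in> carrier \<A> \<Longrightarrow> x \<in> carrier \<A> \<Longrightarrow> a \<oplus> (b \<oplus> x) = b \<oplus> (a \<oplus> x)"
    by (simp_all add: R.add.m_ac)
  show "a \<in> carrier \<A> \<Longrightarrow> invol \<A> a \<in> carrier \<A>" by (rule unital_star_algebra.invol_closed[OF U])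
qed

lemma invol_one:
  fixes \<A> :: "'u star_algebra" (structure)
  assumes U: "unital_star_algebra \<A>" shows "invol \<A> \<one> = \<one>"
proof -
  note D = unital_star_algebraD[OF U]
  have i: "invol \<A> (invol \<A> \<one>) = \<one>" by (rule unital_star_algebra.invol_invol[OF U D(1)])
  have "\<one> = invol \<A> (invol \<A> \<one> \<otimes> \<one>)" using D(1) by (simp add: D i)
  also have "\<dots> = invol \<A> \<one> \<otimes> \<one>"
    using unital_star_algebra.invol_mult[OF U D(21)[OF D(1)] D(1)] by (simp add: i)
  finally show ?thesis using D(1) by (simp add: D)
qed

lemma linear_form_algebra_iff:
  "linear_form (algebra_space \<A>) \<phi> \<longleftrightarrow>
     (\<forall>a\<in>carrier \<A>. \<forall>b\<in>carrier \<A>. \<phi> (a \<oplus>\<^bsub>\<A>\<^esub> b) = \<phi> a + \<phi> b) \<and>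
     (\<forall>c. \<forall>a\<in>carrier \<A>. \<phi> (c \<odot>\<^bsub>\<A>\<^esub> a) = c * \<phi> a)"
  by (simp add: linear_form_def algebra_space_def)

lemma linear_form_translate:
  fixes \<A> :: "'u star_algebra" (structure)
  assumes U: "unital_star_algebra \<A>" and "linear_form (algebra_space \<A>) \<phi>" and "b \<in> carrier \<A>"
  shows "linear_form (algebra_space \<A>) (\<lambda>a. \<phi> (a \<otimes> b))"
    and "linear_form (algebra_space \<A>) (\<lambda>a. \<phi> (b \<otimes> a))"
  using assms(2,3) unital_star_algebra.smult_mult_left[OF U] unital_star_algebra.smult_mult_right[OF U]
  by (auto simp: linear_form_algebra_iff unital_star_algebraD[OF U])

definition subspace_of :: "'u star_algebra \<Rightarrow> 'u set \<Rightarrow> bool" where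
  "subspace_of \<A> W \<longleftrightarrow> W \<subseteq> carrier \<A> \<and> zero \<A> \<in> W \<and>
     (\<forall>a\<in>W. \<forall>b\<in>W. a \<oplus>\<^bsub>\<A>\<^esub> b \<in> W) \<and> (\<forall>c. \<forall>a\<in>W. c \<odot>\<^bsub>\<A>\<^esub> a \<in> W)"

lemma maximal_subspace_avoiding_one:
  fixes \<A> :: "'u star_algebra" (structure)
  assumes U: "unital_star_algebra \<A>" and ne: "carrier \<A> \<noteq> {\<zero>}"
  shows "\<exists>W. subspace_of \<A> W \<and> \<one> \<notin> W \<and> (\<forall>X. subspace_of \<A> X \<longrightarrow> \<one> \<notin> X \<longrightarrow> W \<subseteq> X \<longrightarrow> X = W)"
proof -
  note D = unital_star_algebraD[OF U]
  have one: "\<one> \<noteq> \<zero>"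
  proof
    assume *: "\<one> = \<zero>"
    have "a = \<zero>" if a: "a \<in> carrier \<A>" for a
    proof -
      have "(0 \<odot> \<one>) \<otimes> a = 0 \<odot> (\<one> \<otimes> a)" using unital_star_algebra.smult_mult_left[OF U] D(1) a by blast
      then show ?thesis using a D(1) by (simp add: D *[symmetric])
    qed
    then show False using ne D(2) by blast
  qed
  let ?S = "{W. subspace_of \<A> W \<and> \<one> \<notin> W}"
  have "\<exists>M\<in>?S. \<forall>X\<in>?S. M \<subseteq> X \<longrightarrow> X = M"
  proof (rule subset_Zorn_nonempty)
    have "{\<zero>} \<in> ?S" using one D(2) by (simp add: subspace_of_def D)
    then show "?S \<noteq> {}" by blast
    fix C assume C: "C \<noteq> {}" "subset.chain ?S C"
    then have sub: "\<And>W. W \<in> C \<Longrightarrow> subspace_of \<A> W \<and> \<one> \<notin> W"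
      and cmp: "\<And>V W. V \<in> C \<Longrightarrow> W \<in> C \<Longrightarrow> V \<subseteq> W \<or> W \<subseteq> V"
      by (auto simp: subset_chain_def)
    have "a \<oplus> b \<in> \<Union>C" if ab: "a \<in> \<Union>C" "b \<in> \<Union>C" for a b
    proof -
      obtain V W where V: "V \<in> C" "a \<in> V" and W: "W \<in> C" "b \<in> W" using ab by blast
      then have "\<exists>X\<in>C. a \<in> X \<and> b \<in> X" using cmp[OF V(1) W(1)] by blast
      then show ?thesis using sub unfolding subspace_of_def by blast
    qed
    then have "subspace_of \<A> (\<Union>C)"
      using sub C(1) unfolding subspace_of_def by blast
    then show "\<Union>C \<in> ?S" using sub by blast
  qed
  then show ?thesis by blast
qed

text \<open>Tensor equality is tested by bilinear forms, so a nonzero algebra can only be exploited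
  through a linear form with \<open>\<phi> 1 = 1\<close>. If \<open>W\<close> is a maximal subspace that avoids \<open>1\<close>, then
  every element is in \<open>c 1 + W\<close> for a unique \<open>c\<close>, and \<open>\<phi>\<close> reads off \<open>c\<close>.\<close>

lemma linear_form_unital:
  fixes \<A> :: "'u star_algebra" (structure)
  assumes U: "unital_star_algebra \<A>" and ne: "carrier \<A> \<noteq> {\<zero>}"
  shows "\<exists>\<phi>. linear_form (algebra_space \<A>) \<phi> \<and> \<phi> \<one> = 1"
proof -
  note D = unital_star_algebraD[OF U]
  obtain W where W: "subspace_of \<A> W" "\<one> \<notin> W"
    and max: "\<And>X. subspace_of \<A> X \<Longrightarrow> \<one> \<notin> X \<Longrightarrow> W \<subseteq> X \<Longrightarrow> X = W"
    using maximal_subspace_avoiding_one[OF U ne] by blast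
  have sub: "a \<in> W \<Longrightarrow> a \<in> carrier \<A>" and W0: "\<zero> \<in> W"
    and Wadd: "a \<in> W \<Longrightarrow> b \<in> W \<Longrightarrow> a \<oplus> b \<in> W" and Wscale: "a \<in> W \<Longrightarrow> c \<odot> a \<in> W" for a b c
    using W(1) by (auto simp: subspace_of_def)
  have cancel: "(x \<oplus> c \<odot> y) \<oplus> (- c) \<odot> y = x" if "x \<in> carrier \<A>" "y \<in> carrier \<A>" for x y c
  proof -
    have "c \<odot> y \<oplus> (- c) \<odot> y = \<zero>" using that D(11)[of y c "- c"] by (simp add: D)
    then show ?thesis using that by (simp add: D)
  qed
  have ex: "\<exists>c. a \<oplus> (- c) \<odot> \<one> \<in> W" if a: "a \<in> carrier \<A>" for a
  proof (cases "a \<in> W")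
    case True
    then show ?thesis using a D(1) by (intro exI[of _ 0]) (simp add: D)
  next
    case False
    let ?X = "{w \<oplus> c \<odot> a | w c. w \<in> W}"
    have "subspace_of \<A> ?X"
      unfolding subspace_of_def
    proof (intro conjI ballI allI)
      show "?X \<subseteq> carrier \<A>" using a sub by (auto simp: D)
      show "\<zero> \<in> ?X" using W0 a D(2) by (auto simp: D intro!: exI[of _ \<zero>] exI[of _ 0])
      fix x assume "x \<in> ?X"
      then obtain w c where x: "x = w \<oplus> c \<odot> a" "w \<in> W" by blast
      show "k \<odot> x \<in> ?X" for k
        using x a sub Wscale by (auto simp: D intro!: exI[of _ "k \<odot> w"] exI[of _ "k * c"])
      fix y assume "y \<in> ?X"
      then obtain w' c' where y: "y = w' \<oplus> c' \<odot> a" "w' \<in> W" by blast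
      show "x \<oplus> y \<in> ?X"
        using x y a sub Wadd by (auto simp: D intro!: exI[of _ "w \<oplus> w'"] exI[of _ "c + c'"])
    qed
    moreover have "W \<subseteq> ?X"
    proof
      fix w assume "w \<in> W"
      then show "w \<in> ?X" using a sub by (auto simp: D intro!: exI[of _ w] exI[of _ 0])
    qed
    moreover have "a \<in> ?X" using a W0 by (auto simp: D intro!: exI[of _ \<zero>] exI[of _ 1])
    ultimately have "\<one> \<in> ?X" using max[of ?X] False by blast
    then obtain w c where w: "\<one> = w \<oplus> c \<odot> a" "w \<in> W" by blast
    have c0: "c \<noteq> 0"
    proof
      assume "c = 0"
      then have "\<one> = w" using w a sub by (simp add: D)
      then show False using w(2) W(2) by simp
    qed
    have "(- (1 / c)) \<odot> \<one> = (- (1 / c)) \<odot> w \<oplus> (- 1) \<odot> a"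
      using w a sub c0 D(10)[of w "c \<odot> a" "- (1 / c)"] D(12)[of a "- (1 / c)" c] by (simp add: D)
    then have "a \<oplus> (- (1 / c)) \<odot> \<one> = ((- (1 / c)) \<odot> w \<oplus> 1 \<odot> a) \<oplus> (- 1) \<odot> a"
      using a w(2) sub D(20) by (simp add: D)
    also have "\<dots> = (- (1 / c)) \<odot> w" using a w(2) sub by (intro cancel) (simp_all add: D)
    finally show ?thesis using Wscale[OF w(2)] by (intro exI[of _ "1 / c"]) simp
  qed
  have uniq: "c = c'" if a: "a \<in> carrier \<A>" and c: "a \<oplus> (- c) \<odot> \<one> \<in> W" "a \<oplus> (- c') \<odot> \<one> \<in> W" for a c c'
  proof (rule ccontr)
    assume "c \<noteq> c'"
    have "(a \<oplus> (- c) \<odot> \<one>) \<oplus> (- 1) \<odot> (a \<oplus> (- c') \<odot> \<one>) \<in> W" using Wadd Wscale c by blast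
    also have "(a \<oplus> (- c) \<odot> \<one>) \<oplus> (- 1) \<odot> (a \<oplus> (- c') \<odot> \<one>)
        = ((- c) \<odot> \<one> \<oplus> c' \<odot> \<one>) \<oplus> (1 \<odot> a \<oplus> (- 1) \<odot> a)"
      using a D(1) D(12)[of \<one> "- 1" "- c'"] by (simp add: D)
    also have "\<dots> = (c' - c) \<odot> \<one>"
    proof -
      have "1 \<odot> a \<oplus> (- 1) \<odot> a = \<zero>" using D(11)[OF a, of 1 "- 1"] D(14)[OF a] by simp
      moreover have "(- c) \<odot> \<one> \<oplus> c' \<odot> \<one> = (c' - c) \<odot> \<one>" using D(11)[OF D(1), of "- c" c'] by simp
      ultimately show ?thesis using D(1) by (simp add: D)
    qed
    finally have "(1 / (c' - c)) \<odot> ((c' - c) \<odot> \<one>) \<in> W" by (rule Wscale)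
    then have "\<one> \<in> W" using \<open>c \<noteq> c'\<close> D(1) D(12)[of \<one> "1 / (c' - c)" "c' - c"] by (simp add: D)
    then show False using W(2) by simp
  qed
  define \<phi> where "\<phi> a = (THE c. a \<oplus> (- c) \<odot> \<one> \<in> W)" for a
  have phiI: "\<phi> a = c" if "a \<in> carrier \<A>" "a \<oplus> (- c) \<odot> \<one> \<in> W" for a c
    unfolding \<phi>_def using that uniq by blast
  have phi: "a \<oplus> (- \<phi> a) \<odot> \<one> \<in> W" if a: "a \<in> carrier \<A>" for a
    using ex[OF a] phiI[OF a] by auto
  have "linear_form (algebra_space \<A>) \<phi>"
    unfolding linear_form_algebra_iff
  proof (intro conjI ballI allI)
    fix a b assume ab: "a \<in> carrier \<A>" "b \<in> carrier \<A>"
    have "(a \<oplus> b) \<oplus> (- (\<phi> a + \<phi> b)) \<odot> \<one> = (a \<oplus> (- \<phi> a) \<odot> \<one>) \<oplus> (b \<oplus> (- \<phi> b) \<odot> \<one>)"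
      using ab D(1) D(11)[of \<one> "- \<phi> a" "- \<phi> b"] by (simp add: D)
    also have "\<dots> \<in> W" using phi ab Wadd by blast
    finally show "\<phi> (a \<oplus> b) = \<phi> a + \<phi> b" using ab by (intro phiI) (simp_all add: D)
  next
    fix a c assume a: "a \<in> carrier \<A>"
    have "c \<odot> a \<oplus> (- (c * \<phi> a)) \<odot> \<one> = c \<odot> (a \<oplus> (- \<phi> a) \<odot> \<one>)"
      using a D(1) D(12)[of \<one> c "- \<phi> a"] by (simp add: D)
    also have "\<dots> \<in> W" using phi a Wscale by blast
    finally show "\<phi> (c \<odot> a) = c * \<phi> a" using a by (intro phiI) (simp_all add: D)
  qed
  moreover have "\<phi> \<one> = 1"
    using cancel[of \<zero> \<one> 1] W0 D(1,2) by (intro phiI) (simp_all add: D)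
  ultimately show ?thesis by blast
qed

section \<open>A copy of the complex numbers as a color algebra\<close>

text \<open>The complex numbers, transported along an injection into the type that color algebras are
  drawn from. The identity gives the color algebra of local colorings.\<close>

definition copy_algebra :: "(complex \<Rightarrow> 'u) \<Rightarrow> 'u star_algebra" where
  "copy_algebra emb =
     \<lparr>carrier = range emb, mult = (\<lambda>a b. emb (inv_into UNIV emb a * inv_into UNIV emb b)), one = emb 1, zero = emb 0,
      add = (\<lambda>a b. emb (inv_into UNIV emb a + inv_into UNIV emb b)), smult = (\<lambda>c a. emb (c * inv_into UNIV emb a)),
      invol = (\<lambda>a. emb (cnj (inv_into UNIV emb a)))\<rparr>"

lemma copy_algebra_id: "copy_algebra id = complex_algebra"
  by (auto simp: copy_algebra_def complex_algebra_def fun_eq_iff)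

lemma copy_algebra:
  assumes "inj emb"
  shows "unital_star_algebra (copy_algebra emb)" "carrier (copy_algebra emb) \<noteq> {zero (copy_algebra emb)}"
proof -
  let ?A = "copy_algebra emb"
  have i [simp]: "inv_into UNIV emb (emb z) = z" for z using assms by simp
  have "cring complex_ring"
    by (intro cringI abelian_groupI comm_monoidI)
      (auto simp: complex_ring_def algebra_simps intro: exI[of _ "- _"])
  moreover have ab: "abelian_group ?A"
  proof (rule abelian_groupI)
    fix x assume "x \<in> carrier ?A"
    then obtain z where "x = emb z" by (auto simp: copy_algebra_def)
    then show "\<exists>y\<in>carrier ?A. y \<oplus>\<^bsub>?A\<^esub> x = \<zero>\<^bsub>?A\<^esub>"
      by (intro bexI[of _ "emb (- z)"]) (simp_all add: copy_algebra_def)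
  qed (auto simp: copy_algebra_def algebra_simps)
  ultimately have "Module.module complex_ring ?A"
    by (intro Module.moduleI) (auto simp: copy_algebra_def complex_ring_def algebra_simps)
  moreover have "ring ?A"
    by (intro ringI ab monoidI) (auto simp: copy_algebra_def algebra_simps)
  moreover have "unital_star_algebra_axioms ?A"
    by standard (auto simp: copy_algebra_def algebra_simps)
  ultimately show "unital_star_algebra ?A" by (intro unital_star_algebra.intro)
  have "emb 1 \<noteq> emb 0" using assms by (metis injD zero_neq_one)
  then show "carrier ?A \<noteq> {zero ?A}" by (auto simp: copy_algebra_def)
qed

section \<open>Two-colorings\<close>

lemma sum_list_swap:
  "(\<Sum>x\<leftarrow>xs. \<Sum>y\<leftarrow>ys. f x y) = (\<Sum>y\<leftarrow>ys. \<Sum>x\<leftarrow>xs. f x y :: 'c::comm_monoid_add)"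
  by (induction xs) (simp_all add: sum_list_addf)

lemma sum_tensor_map:
  "(\<Sum>(z, c)\<leftarrow>tensor_map S T t. \<gamma> z c) = (\<Sum>(x, a)\<leftarrow>t. \<gamma> (S x) (T a))"
  by (simp add: tensor_map_def o_def case_prod_unfold)

lemma sum_tensor_prod:
  fixes \<gamma> :: "_ \<Rightarrow> _ \<Rightarrow> 'c::comm_monoid_add"
  shows "(\<Sum>(z, c)\<leftarrow>tensor_prod p q s t. \<gamma> z c) = (\<Sum>(x, a)\<leftarrow>s. \<Sum>(y, b)\<leftarrow>t. \<gamma> (p x y) (q a b))"
proof (induction s)
  case Nil
  show ?case by (simp add: tensor_prod_def)
next
  case (Cons xa s)
  obtain x a where xa: "xa = (x, a)" by force
  have "(\<Sum>(z, c)\<leftarrow>map (\<lambda>(y, b). (p x y, q a b)) t. \<gamma> z c) = (\<Sum>(y, b)\<leftarrow>t. \<gamma> (p x y) (q a b))"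
    by (simp add: o_def case_prod_unfold)
  moreover have "tensor_prod p q (xa # s) t = map (\<lambda>(y, b). (p x y, q a b)) t @ tensor_prod p q s t"
    by (simp add: tensor_prod_def xa case_prod_unfold concat_map_singleton)
  ultimately show ?case using Cons.IH by (simp add: xa)
qed

lemma tensor_eqD:
  "tensor_eq X Y s t \<Longrightarrow> bilinear_form X Y \<beta> \<Longrightarrow> (\<Sum>(x, a)\<leftarrow>s. \<beta> x a) = (\<Sum>(x, a)\<leftarrow>t. \<beta> x a)"
  by (auto simp: tensor_eq_def)

lemma tensor_eq_refl: "tensor_eq X Y s s"
  by (simp add: tensor_eq_def)

lemma tensor_eq_sym: "tensor_eq X Y s t \<Longrightarrow> tensor_eq X Y t s"
  by (simp add: tensor_eq_def)

lemma tensor_eq_trans: "tensor_eq X Y s t \<Longrightarrow> tensor_eq X Y t u \<Longrightarrow> tensor_eq X Y s u"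
  by (simp add: tensor_eq_def)

lemma bilinear_form_full_iff:
  "bilinear_form full_space (algebra_space \<A>) \<beta> \<longleftrightarrow>
    (\<forall>a\<in>carrier \<A>. clinear (\<lambda>x. \<beta> x a)) \<and> (\<forall>x. linear_form (algebra_space \<A>) (\<beta> x))"
  by (simp add: bilinear_form_def linear_form_def full_space_def algebra_space_def clinear_iff)

lemma bilinear_form_product:
  assumes "clinear g" "linear_form (algebra_space \<A>) \<phi>"
  shows "bilinear_form full_space (algebra_space \<A>) (\<lambda>x a. g x * \<phi> a)"
  using assms by (simp add: bilinear_form_full_iff clinear_iff linear_form_algebra_iff algebra_simps)

lemma bilinear_form_sum:
  assumes "\<And>x a. (x, a) \<in> set t \<Longrightarrow> bilinear_form X Y (\<beta> x a)"
  shows "bilinear_form X Y (\<lambda>y b. \<Sum>(x, a)\<leftarrow>t. \<beta> x a y b)"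
  using assms
proof (induction t)
  case Nil
  show ?case by (simp add: bilinear_form_def linear_form_def)
next
  case (Cons xa t)
  obtain x a where xa: "xa = (x, a)" by force
  show ?case
    using Cons.IH Cons.prems[of x a] Cons.prems
    by (simp add: xa bilinear_form_def linear_form_def algebra_simps)
qed

text \<open>A form that is bilinear in each of two tensors can be evaluated on any representatives of
  them.\<close>

lemma tensor_eq_double:
  assumes s: "tensor_eq X Y s s'" and t: "tensor_eq X Y t t'"
    and sub: "set s' \<subseteq> vecs X \<times> vecs Y" "set t \<subseteq> vecs X \<times> vecs Y"
    and l: "\<And>y b. y \<in> vecs X \<Longrightarrow> b \<in> vecs Y \<Longrightarrow> bilinear_form X Y (\<lambda>x a. \<beta> x a y b)"
    and r: "\<And>x a. x \<in> vecs X \<Longrightarrow> a \<in> vecs Y \<Longrightarrow> bilinear_form X Y (\<beta> x a)"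
  shows "(\<Sum>(x, a)\<leftarrow>s. \<Sum>(y, b)\<leftarrow>t. \<beta> x a y b) = (\<Sum>(x, a)\<leftarrow>s'. \<Sum>(y, b)\<leftarrow>t'. \<beta> x a y b)"
proof -
  have "(\<Sum>(x, a)\<leftarrow>s. \<Sum>(y, b)\<leftarrow>t. \<beta> x a y b) = (\<Sum>(x, a)\<leftarrow>s'. \<Sum>(y, b)\<leftarrow>t. \<beta> x a y b)"
    using sub(2) by (intro tensor_eqD[OF s] bilinear_form_sum) (auto intro: l)
  also have "\<dots> = (\<Sum>(x, a)\<leftarrow>s'. \<Sum>(y, b)\<leftarrow>t'. \<beta> x a y b)"
    using sub(1)
    by (intro arg_cong[of _ _ sum_list] map_cong) (auto intro!: tensor_eqD[OF t] r)
  finally show ?thesis .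
qed

text \<open>The contraction \<open>id \<otimes> \<phi>\<close>. Equal tensors have equal slices, and in this way identities in
  \<open>B \<otimes> \<A>\<close> become identities in \<open>B\<close>.\<close>

definition slice :: "('u \<Rightarrow> complex) \<Rightarrow> ('b::complex_star_algebra \<times> 'u) list \<Rightarrow> 'b" where
  "slice \<phi> t = (\<Sum>(x, a)\<leftarrow>t. \<phi> a *\<^sub>C x)"

lemma clinear_sum_list: "clinear f \<Longrightarrow> f (\<Sum>(x, a)\<leftarrow>t. g x a) = (\<Sum>(x, a)\<leftarrow>t. f (g x a))"
  by (induction t) (auto simp: clinear_zero clinear_add)

lemma slice_append: "slice \<phi> (s @ t) = slice \<phi> s + slice \<phi> t"
  by (simp add: slice_def)

lemma slice_mult: "slice \<phi> t * y = (\<Sum>(x, a)\<leftarrow>t. \<phi> a *\<^sub>C (x * y))"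
  unfolding slice_def
  by (subst clinear_sum_list[of "\<lambda>x. x * y"])
    (simp_all add: clinear_iff distrib_right mult_scaleC_left)

lemma (in parseval_frame) slice_eq:
  fixes s t :: "('b \<times> 'u) list"
  assumes st: "tensor_eq full_space (algebra_space \<A>) s t" and \<phi>: "linear_form (algebra_space \<A>) \<phi>"
  shows "slice \<phi> s = slice \<phi> t"
proof -
  let ?z = "slice \<phi> s - slice \<phi> t"
  have g: "clinear (\<lambda>x. \<psi> (star y * x))" for y
    by (simp add: clinear_iff distrib_left psi_add mult_scaleC_right psi_scale)
  have c: "\<psi> (star y * slice \<phi> u) = (\<Sum>(x, a)\<leftarrow>u. \<psi> (star y * x) * \<phi> a)" for y and u :: "('b \<times> 'u) list"
    unfolding slice_def
    by (subst clinear_sum_list[OF g]) (simp add: mult_scaleC_right psi_scale mult.commute)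
  have "\<psi> (star ?z * slice \<phi> s) = \<psi> (star ?z * slice \<phi> t)"
    unfolding c by (rule tensor_eqD[OF st bilinear_form_product[OF g \<phi>]])
  then have "\<psi> (star ?z * ?z) = 0" by (simp add: right_diff_distrib psi_diff)
  then have "?z = 0" using faithful_stateD(5)[OF state] by blast
  then show ?thesis by simp
qed

text \<open>The involution is antilinear, so a form is pulled back along it with a conjugation.\<close>

lemma tensor_eq_star:
  fixes \<A> :: "'u star_algebra" and s t :: "('b::complex_star_algebra \<times> 'u) list"
  assumes U: "unital_star_algebra \<A>"
    and st: "tensor_eq full_space (algebra_space \<A>) s t"
  shows "tensor_eq full_space (algebra_space \<A>)
    (tensor_map star (invol \<A>) s) (tensor_map star (invol \<A>) t)"
  unfolding tensor_eq_def
proof (intro allI impI)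
  fix \<beta> :: "'b \<Rightarrow> 'u \<Rightarrow> complex"
  assume \<beta>: "bilinear_form full_space (algebra_space \<A>) \<beta>"
  have "bilinear_form full_space (algebra_space \<A>) (\<lambda>x a. cnj (\<beta> (star x) (invol \<A> a)))"
    using \<beta> unital_star_algebra.invol_add[OF U] unital_star_algebra.invol_smult[OF U]
      unital_star_algebra.invol_closed[OF U]
    by (simp add: bilinear_form_full_iff clinear_iff linear_form_algebra_iff star_simps)
  then have "(\<Sum>(x, a)\<leftarrow>s. cnj (\<beta> (star x) (invol \<A> a))) = (\<Sum>(x, a)\<leftarrow>t. cnj (\<beta> (star x) (invol \<A> a)))"
    by (rule tensor_eqD[OF st])
  moreover have "cnj (\<Sum>(x, a)\<leftarrow>u. cnj (\<beta> (star x) (invol \<A> a))) = (\<Sum>(x, a)\<leftarrow>u. \<beta> (star x) (invol \<A> a))"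
    for u :: "('b \<times> 'u) list"
    by (induction u) auto
  ultimately show "(\<Sum>(x, a)\<leftarrow>tensor_map star (invol \<A>) s. \<beta> x a) =
      (\<Sum>(x, a)\<leftarrow>tensor_map star (invol \<A>) t. \<beta> x a)"
    unfolding sum_tensor_map by metis
qed

context regular_graph
begin

lemma clinear_schur:
  assumes T: "clinear T" shows "clinear (schur \<psi> A T)"
  by (simp add: clinear_iff schur_eq_sum[OF linear_A T] distrib_right A_add sum.distrib scaleC_add_right
      mult_scaleC_left A_scale cvs.scale_sum_right[symmetric] cvs.scale_left_commute)

text \<open>The coloring is \<open>v \<mapsto> splitting p v \<otimes> 1\<close>. The two blocks \<open>p S p\<close> and \<open>(1 - p) S (1 - p)\<close>
  vanish for \<open>S = A\<close> and hence, by the formula for the Schur product, for every \<open>S = A \<bullet> T\<close>.\<close>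

lemma two_coloring_of_bipartition:
  fixes \<A> :: "'u star_algebra"
  assumes U: "unital_star_algebra \<A>" and p: "projection p" and sw: "\<And>b. A (p * b) = (1 - p) * A b"
  shows "two_coloring \<psi> A \<A> (\<lambda>v. [(splitting p v, one \<A>)])"
proof -
  note D = unital_star_algebraD[OF U]
  let ?g = "splitting p"
  have h: "unital_star_hom ?g" by (rule splitting_star_hom[OF p])
  then have lin: "clinear ?g" by (simp add: unital_star_hom_def)
  have pp: "p * p = p" "star p = p" using p by (auto simp: projection_def)
  have z1: "p * A (p * b) = 0" for b
    by (simp add: sw mult.assoc[symmetric]) (simp add: algebra_simps pp)
  have z2: "(1 - p) * A ((1 - p) * b) = 0" for b
  proof -
    have "A ((1 - p) * b) = p * A b" by (simp add: left_diff_distrib A_diff sw)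
    then show ?thesis by (simp add: mult.assoc[symmetric]) (simp add: algebra_simps pp)
  qed
  have hom: "tensor_star_hom \<A> (\<lambda>v. [(?g v, one \<A>)])"
    unfolding tensor_star_hom_def Let_def
  proof (intro conjI allI)
    show "[(?g x, one \<A>)] \<in> tensors UNIV (carrier \<A>)" for x by (simp add: tensors_def D)
    show "tensor_eq full_space (algebra_space \<A>) [(?g (x + y), one \<A>)] ([(?g x, one \<A>)] @ [(?g y, one \<A>)])" for x y
      using D(1) by (simp add: tensor_eq_def bilinear_form_full_iff clinear_add[OF lin] clinear_iff)
  next
    show "tensor_eq full_space (algebra_space \<A>) [(?g (c *\<^sub>C x), one \<A>)]
        (tensor_map ((*\<^sub>C) c) id [(?g x, one \<A>)])" for c x
      by (simp add: tensor_map_def clinear_scale[OF lin] tensor_eq_refl)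
  next
    show "tensor_eq full_space (algebra_space \<A>) [(?g 1, one \<A>)] [(1, one \<A>)]"
      using h by (simp add: unital_star_hom_def tensor_eq_refl)
  next
    show "tensor_eq full_space (algebra_space \<A>) [(?g (x * y), one \<A>)]
        (tensor_prod (*) (mult \<A>) [(?g x, one \<A>)] [(?g y, one \<A>)])" for x y
      using h D(1) by (simp add: unital_star_hom_def tensor_prod_def D tensor_eq_refl)
  next
    show "tensor_eq full_space (algebra_space \<A>) [(?g (star x), one \<A>)]
        (tensor_map star (invol \<A>) [(?g x, one \<A>)])" for x
      using h by (simp add: unital_star_hom_def tensor_map_def invol_one[OF U] tensor_eq_refl)
  qed
  have rep: "represents \<A> [(?g, one \<A>)] (\<lambda>v. [(?g v, one \<A>)])"
    using lin D(1) by (simp add: represents_def tensors_def tensor_map_def tensor_eq_refl)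
  have rel: "adjoint_op tau \<psi> ?g \<circ> (S \<circ> ?g) \<in> quantum_relation tau adj_K2"
    if S: "S \<in> quantum_relation \<psi> A" for S
  proof -
    obtain T where T: "clinear T" "S = schur \<psi> A T" using S by (auto simp: quantum_relation_def)
    have ST: "clinear S" using clinear_schur T by blast
    have "p * S p = 0" "(1 - p) * S (1 - p) = 0"
      by (simp_all add: T(2) schur_eq_sum[OF linear_A T(1)] mult_scaleC_right sum_distrib_left
          mult.assoc[symmetric] z1 z2)
    then have "(adjoint_op tau \<psi> ?g \<circ> (S \<circ> ?g)) (pt i) $ i = 0" for i
      using exhaust_2[of i] by (auto simp: adjoint_tau(2)[OF state lin] star_diff pp psi_zero)
    moreover have "clinear (adjoint_op tau \<psi> ?g \<circ> (S \<circ> ?g))"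
      using lin ST adjoint_tau(1)[OF state lin] by (simp add: clinear_iff)
    ultimately show ?thesis by (simp add: quantum_relation_K2)
  qed
  show ?thesis
    unfolding two_coloring_def
  proof (intro conjI exI[of _ "[(?g, one \<A>)]"] hom rep ballI)
    fix S assume S: "S \<in> quantum_relation \<psi> A"
    show "\<exists>G\<in>tensors (quantum_relation tau adj_K2) (carrier \<A>).
        tensor_eq hom_space (algebra_space \<A>)
          (tensor_prod (\<circ>) (mult \<A>) (tensor_map (adjoint_op tau \<psi>) (invol \<A>) [(?g, one \<A>)])
            (tensor_prod (\<circ>) (mult \<A>) [(S, one \<A>)] [(?g, one \<A>)])) G"
      using rel[OF S] D(1)
      by (intro bexI[of _ "[(adjoint_op tau \<psi> ?g \<circ> (S \<circ> ?g), one \<A>)]"])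
        (simp_all add: tensors_def tensor_prod_def tensor_map_def invol_one[OF U] D tensor_eq_refl)
  qed
qed

text \<open>These operators are \<open>A \<bullet> T\<close> for the rank one operator \<open>T y = \<delta>\<^sup>2 \<psi> (y z) w\<close>. They carry the
  information in a coloring: \<open>w\<close> is a free factor under \<open>\<psi>\<close>, which is faithful.\<close>

lemma elementary_in_relation:
  "(\<lambda>y. A (y * z) * w) \<in> quantum_relation \<psi> A"
proof -
  define T where "T y = complex_of_real ((delta \<psi>)\<^sup>2) *\<^sub>C \<psi> (y * z) *\<^sub>C w" for y
  have T: "clinear T"
    by (simp add: clinear_iff T_def distrib_right psi_add scaleC_add_left scaleC_add_right mult_scaleC_left
        psi_scale scaleC_scaleC mult.left_commute)
  have "schur \<psi> A T x = A (x * z) * w" for x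
  proof -
    have "schur \<psi> A T x = (\<Sum>e\<in>E. \<psi> (star e * z) *\<^sub>C (A (x * e) * w))"
      using delta_nonzero
      by (simp add: schur_eq_sum[OF linear_A T] T_def mult_scaleC_right cvs.scale_sum_right scaleC_scaleC)
    also have "\<dots> = A (x * (\<Sum>e\<in>E. \<psi> (star e * z) *\<^sub>C e)) * w"
      by (simp add: sum_distrib_left mult_scaleC_right A_sum A_scale sum_distrib_right mult_scaleC_left)
    finally show ?thesis unfolding frame_expansion[of z, symmetric] .
  qed
  then have "(\<lambda>y. A (y * z) * w) = schur \<psi> A T" by auto
  then show ?thesis unfolding quantum_relation_def using T by blast
qed

text \<open>The \<open>i\<close>-th diagonal entry of \<open>f\<^sup>\<dagger> (S \<otimes> 1) f\<close> is \<open>2 (\<psi> \<otimes> id) (P\<^sup>* (S \<otimes> 1) P)\<close>, where \<open>P\<close> is the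
  image of the \<open>i\<close>-th point, and \<open>P\<^sup>* = P\<close>. It vanishes for all \<open>S\<close> of the form
  \<open>y \<mapsto> A (y z) w\<close>, and choosing \<open>w\<close> to be the adjoint of a slice of \<open>P (A \<otimes> 1) (P (z \<otimes> 1))\<close> makes
  that slice vanish itself.\<close>

lemma coloring_zero_block:
  fixes \<A> :: "'u star_algebra" (structure)
  assumes U: "unital_star_algebra \<A>" and col: "two_coloring \<psi> A \<A> f"
    and \<phi>: "linear_form (algebra_space \<A>) \<phi>"
  shows "(\<Sum>(x, a)\<leftarrow>f (pt i). \<Sum>(y, b)\<leftarrow>f (pt i). \<phi> (a \<otimes> b) *\<^sub>C (x * A (y * z))) = 0"
    (is "?w = 0")
proof -
  note D = unital_star_algebraD[OF U]
  obtain F where hom: "tensor_star_hom \<A> f" and rep: "represents \<A> F f"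
    and rel: "\<And>S. S \<in> quantum_relation \<psi> A \<Longrightarrow> \<exists>G\<in>tensors (quantum_relation tau adj_K2) (carrier \<A>).
          tensor_eq hom_space (algebra_space \<A>)
            (tensor_prod (\<circ>) (mult \<A>) (tensor_map (adjoint_op tau \<psi>) (invol \<A>) F)
              (tensor_prod (\<circ>) (mult \<A>) [(S, \<one>)] F)) G"
    using col unfolding two_coloring_def by blast
  let ?e = "pt i" and ?eq = "tensor_eq (full_space :: 'b cspace) (algebra_space \<A>)"
  let ?X = "f ?e" and ?X' = "tensor_map (\<lambda>T. T ?e) id F"
  let ?Xs = "tensor_map star (invol \<A>) ?X'"
  have F: "clinear T" "a \<in> carrier \<A>" if "(T, a) \<in> set F" for T a
    using rep that by (auto simp: represents_def tensors_def)
  have X': "?eq ?X' ?X" using rep by (simp add: represents_def)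
  have "star ?e = ?e" by (simp add: vec_eq_iff)
  then have "?eq ?X (tensor_map star (invol \<A>) ?X)" using hom unfolding tensor_star_hom_def Let_def by metis
  then have Xs: "?eq ?Xs ?X"
    by (rule tensor_eq_trans[OF tensor_eq_star[OF U X'] tensor_eq_sym])
  have Xc: "set ?X \<subseteq> UNIV \<times> carrier \<A>" using hom by (auto simp: tensor_star_hom_def Let_def tensors_def)
  have X'c: "set ?X' \<subseteq> UNIV \<times> carrier \<A>" using F by (auto simp: tensor_map_def)
  define S where "S y = A (y * z) * star ?w" for y
  have S: "clinear S"
    by (simp add: clinear_iff S_def distrib_right A_add A_scale mult_scaleC_left)
  obtain G where G: "G \<in> tensors (quantum_relation tau adj_K2) (carrier \<A>)"
    "tensor_eq hom_space (algebra_space \<A>)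
            (tensor_prod (\<circ>) (mult \<A>) (tensor_map (adjoint_op tau \<psi>) (invol \<A>) F)
              (tensor_prod (\<circ>) (mult \<A>) [(S, \<one>)] F)) G"
    using rel[OF elementary_in_relation[of z "star ?w"]] unfolding S_def[abs_def] by blast
  have "bilinear_form hom_space (algebra_space \<A>) (\<lambda>R a. R ?e $ i * \<phi> a)"
    using \<phi> by (simp add: bilinear_form_def linear_form_def hom_space_def algebra_space_def algebra_simps)
  from tensor_eqD[OF G(2) this]
  have "(\<Sum>(T, a)\<leftarrow>F. \<Sum>(T', b)\<leftarrow>F. adjoint_op tau \<psi> T (S (T' ?e)) $ i * \<phi> (invol \<A> a \<otimes> (\<one> \<otimes> b)))
      = (\<Sum>(R, a)\<leftarrow>G. R ?e $ i * \<phi> a)"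
    by (simp add: sum_tensor_prod sum_tensor_map)
  also have "\<dots> = (\<Sum>(R, a)\<leftarrow>G. 0)"
    using G(1) by (intro arg_cong[of _ _ sum_list] map_cong)
      (auto simp: tensors_def quantum_relation_K2)
  also have "\<dots> = 0" by (simp add: case_prod_unfold)
  also have "(\<Sum>(T, a)\<leftarrow>F. \<Sum>(T', b)\<leftarrow>F. adjoint_op tau \<psi> T (S (T' ?e)) $ i * \<phi> (invol \<A> a \<otimes> (\<one> \<otimes> b)))
      = (\<Sum>(T, a)\<leftarrow>F. \<Sum>(T', b)\<leftarrow>F. 2 * (\<psi> (star (T ?e) * S (T' ?e)) * \<phi> (invol \<A> a \<otimes> b)))"
    using F by (intro arg_cong[of _ _ sum_list] map_cong) (auto simp: adjoint_tau(2)[OF state] D intro!: arg_cong[of _ _ sum_list] map_cong)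
  also have "\<dots> = (\<Sum>(x, a)\<leftarrow>?Xs. \<Sum>(y, b)\<leftarrow>?X'. 2 * (\<psi> (x * S y) * \<phi> (a \<otimes> b)))"
    by (simp add: sum_tensor_map)
  also have "\<dots> = (\<Sum>(x, a)\<leftarrow>?X. \<Sum>(y, b)\<leftarrow>?X. 2 * (\<psi> (x * S y) * \<phi> (a \<otimes> b)))"
  proof (rule tensor_eq_double[OF Xs X'])
    show "set ?X \<subseteq> vecs full_space \<times> vecs (algebra_space \<A>)" "set ?X' \<subseteq> vecs full_space \<times> vecs (algebra_space \<A>)"
      using Xc X'c by (simp_all add: full_space_def algebra_space_def)
    fix x :: 'b and a assume "a \<in> vecs (algebra_space \<A>)"
    then have a: "a \<in> carrier \<A>" by (simp add: algebra_space_def)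
    show "bilinear_form full_space (algebra_space \<A>) (\<lambda>y b. 2 * (\<psi> (x * S y) * \<phi> (a \<otimes> b)))"
      using linear_form_translate(2)[OF U \<phi> a]
      by (simp add: bilinear_form_full_iff linear_form_algebra_iff clinear_iff distrib_left distrib_right
          mult_scaleC_right psi_add psi_scale clinear_add[OF S] clinear_scale[OF S] mult.left_commute)
    show "bilinear_form full_space (algebra_space \<A>) (\<lambda>y b. 2 * (\<psi> (y * S x) * \<phi> (b \<otimes> a)))"
      using linear_form_translate(1)[OF U \<phi> a]
      by (simp add: bilinear_form_full_iff linear_form_algebra_iff clinear_iff distrib_left distrib_right
          mult_scaleC_left psi_add psi_scale mult.left_commute)
  qed
  also have "\<dots> = 2 * \<psi> (?w * star ?w)"
  proof -
    have "2 * \<psi> ((\<Sum>(x, a)\<leftarrow>t. \<Sum>(y, b)\<leftarrow>t. g x a y b) * v)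
        = (\<Sum>(x, a)\<leftarrow>t. \<Sum>(y, b)\<leftarrow>t. 2 * \<psi> (g x a y b * v))"
      for g :: "'b \<Rightarrow> 'u \<Rightarrow> 'b \<Rightarrow> 'u \<Rightarrow> 'b" and v and t :: "('b \<times> 'u) list"
    proof -
      have c: "clinear (\<lambda>u. 2 * \<psi> (u * v))"
        by (simp add: clinear_iff distrib_right psi_add mult_scaleC_left psi_scale distrib_left)
      show ?thesis by (simp add: clinear_sum_list[OF c])
    qed
    then show ?thesis
      by (simp add: S_def mult_scaleC_left psi_scale mult.assoc mult.left_commute mult.commute)
  qed
  finally have "\<psi> (star ?w * ?w) = 0" using trace[of "star ?w" ?w] by simp
  then show ?thesis using faithful_stateD(5)[OF state] by blast
qed

text \<open>With \<open>P, Q\<close> the two color projections in \<open>B \<otimes> \<A>\<close>, the vanishing of the blocks \<open>P A P\<close> and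
  \<open>Q A Q\<close> and \<open>P + Q = 1\<close> give \<open>A P = Q A P = Q A\<close>, here applied to \<open>y \<otimes> 1\<close> and read off slice
  by slice.\<close>

lemma coloring_intertwines:
  fixes \<A> :: "'u star_algebra" (structure)
  assumes U: "unital_star_algebra \<A>" and \<phi>: "linear_form (algebra_space \<A>) \<phi>"
    and carr: "set P \<subseteq> UNIV \<times> carrier \<A>" "set Q \<subseteq> UNIV \<times> carrier \<A>"
    and one: "\<And>\<phi>. linear_form (algebra_space \<A>) \<phi> \<Longrightarrow> slice \<phi> P + slice \<phi> Q = \<phi> \<one> *\<^sub>C 1"
    and zP: "\<And>z. (\<Sum>(x, a)\<leftarrow>P. \<Sum>(y, b)\<leftarrow>P. \<phi> (a \<otimes> b) *\<^sub>C (x * A (y * z))) = 0"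
    and zQ: "\<And>z. (\<Sum>(x, a)\<leftarrow>Q. \<Sum>(y, b)\<leftarrow>Q. \<phi> (a \<otimes> b) *\<^sub>C (x * A (y * z))) = 0"
  shows "A (slice \<phi> P * z) = slice \<phi> Q * A z"
proof -
  note D = unital_star_algebraD[OF U]
  have A_slice: "A (slice \<theta> P * z) = (\<Sum>(y, b)\<leftarrow>P. \<theta> b *\<^sub>C A (y * z))" for \<theta>
    unfolding slice_mult by (subst clinear_sum_list[OF linear_A]) (simp add: A_scale)
  let ?QAP = "\<Sum>(x, a)\<leftarrow>Q. \<Sum>(y, b)\<leftarrow>P. \<phi> (a \<otimes> b) *\<^sub>C (x * A (y * z))"
  have "A (slice \<phi> P * z) = (\<Sum>(y, b)\<leftarrow>P. (slice (\<lambda>a. \<phi> (a \<otimes> b)) P + slice (\<lambda>a. \<phi> (a \<otimes> b)) Q) * A (y * z))"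
    unfolding A_slice using carr(1)
    by (intro arg_cong[of _ _ sum_list] map_cong)
      (auto simp: one[OF linear_form_translate(1)[OF U \<phi>]] D mult_scaleC_left)
  also have "\<dots> = (\<Sum>(x, a)\<leftarrow>P. \<Sum>(y, b)\<leftarrow>P. \<phi> (a \<otimes> b) *\<^sub>C (x * A (y * z))) + ?QAP"
    by (simp add: distrib_right slice_mult case_prod_unfold sum_list_addf)
      (subst (1 3) sum_list_swap, rule refl)
  also have "\<dots> = ?QAP" by (simp add: zP)
  also have "\<dots> = (\<Sum>(x, a)\<leftarrow>Q. x * (\<phi> a *\<^sub>C A z)) - (\<Sum>(x, a)\<leftarrow>Q. \<Sum>(y, b)\<leftarrow>Q. \<phi> (a \<otimes> b) *\<^sub>C (x * A (y * z)))"
  proof -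
    have "(\<Sum>(y, b)\<leftarrow>P. \<phi> (a \<otimes> b) *\<^sub>C (x * A (y * z))) + (\<Sum>(y, b)\<leftarrow>Q. \<phi> (a \<otimes> b) *\<^sub>C (x * A (y * z)))
        = x * (\<phi> a *\<^sub>C A z)" if a: "a \<in> carrier \<A>" for x a
    proof -
      have c: "clinear (\<lambda>u. x * A (u * z))"
        by (simp add: clinear_iff distrib_left distrib_right A_add A_scale mult_scaleC_left mult_scaleC_right)
      have sl: "x * A (slice (\<lambda>b. \<phi> (a \<otimes> b)) R * z) = (\<Sum>(y, b)\<leftarrow>R. \<phi> (a \<otimes> b) *\<^sub>C (x * A (y * z)))" for R
        unfolding slice_def by (subst clinear_sum_list[OF c]) (simp add: mult_scaleC_left mult_scaleC_right A_scale)
      have "x * A (slice (\<lambda>b. \<phi> (a \<otimes> b)) P * z) + x * A (slice (\<lambda>b. \<phi> (a \<otimes> b)) Q * z)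
          = x * A ((slice (\<lambda>b. \<phi> (a \<otimes> b)) P + slice (\<lambda>b. \<phi> (a \<otimes> b)) Q) * z)"
        by (simp add: distrib_left distrib_right A_add)
      also have "\<dots> = x * (\<phi> a *\<^sub>C A z)"
        using a by (simp add: one[OF linear_form_translate(2)[OF U \<phi> a]] D mult_scaleC_left A_scale)
      finally show ?thesis unfolding sl .
    qed
    then have "(\<Sum>(x, a)\<leftarrow>Q. x * (\<phi> a *\<^sub>C A z)) = (\<Sum>(x, a)\<leftarrow>Q. (\<Sum>(y, b)\<leftarrow>P. \<phi> (a \<otimes> b) *\<^sub>C (x * A (y * z)))
        + (\<Sum>(y, b)\<leftarrow>Q. \<phi> (a \<otimes> b) *\<^sub>C (x * A (y * z))))"
      using carr(2) by (intro arg_cong[of _ _ sum_list] map_cong) auto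
    then show ?thesis by (simp add: case_prod_unfold sum_list_addf)
  qed
  also have "\<dots> = slice \<phi> Q * A z" by (simp add: zQ slice_mult mult_scaleC_right)
  finally show ?thesis .
qed

text \<open>If \<open>A x = c x\<close>, then \<open>A (P - Q) x = - c (P - Q) x\<close>. Were \<open>- c\<close> no eigenvalue, every slice
  of \<open>(P - Q) x\<close> would vanish, so \<open>P x = x / 2\<close> and \<open>P\<^sup>2 x = x / 4\<close>, whereas \<open>P\<^sup>2 = P\<close>.\<close>

lemma spec_symmetric_of_coloring:
  fixes \<A> :: "'u star_algebra" (structure)
  assumes U: "unital_star_algebra \<A>" and ne: "carrier \<A> \<noteq> {\<zero>}"
    and col: "two_coloring \<psi> A \<A> f" and c: "c \<in> spec A"
  shows "- c \<in> spec A"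
proof (rule ccontr)
  assume not: "- c \<notin> spec A"
  note D = unital_star_algebraD[OF U]
  let ?P = "f (pt 1)" and ?Q = "f (pt 2)"
  let ?eq = "tensor_eq (full_space :: 'b cspace) (algebra_space \<A>)"
  have hom: "tensor_star_hom \<A> f" using col by (simp add: two_coloring_def)
  have carr: "set (f v) \<subseteq> UNIV \<times> carrier \<A>" for v
    using hom by (auto simp: tensor_star_hom_def Let_def tensors_def)
  have "?eq (f 1) (?P @ ?Q)" "?eq (f 1) [(1, \<one>)]"
    using hom unfolding tensor_star_hom_def Let_def pt_sum[symmetric] by blast+
  then have "?eq (?P @ ?Q) [(1, \<one>)]" by (meson tensor_eq_sym tensor_eq_trans)
  from slice_eq[OF this]
  have one: "slice \<phi> ?P + slice \<phi> ?Q = \<phi> \<one> *\<^sub>C 1" if "linear_form (algebra_space \<A>) \<phi>" for \<phi>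
    using that by (simp add: slice_append) (simp add: slice_def)
  have "pt 1 * pt 1 = pt 1" by (simp add: vec_eq_iff)
  then have idem: "?eq ?P (tensor_prod (*) (mult \<A>) ?P ?P)"
    using hom unfolding tensor_star_hom_def Let_def by metis
  obtain x where x: "x \<noteq> 0" "A x = c *\<^sub>C x" using c spec_iff by blast
  \<comment> \<open>Slice by slice, \<open>P x - Q x\<close> is in the trivial eigenspace of \<open>- c\<close>, and \<open>P x + Q x = x \<otimes> 1\<close>.\<close>
  have half: "slice \<phi> ?P * x = (\<phi> \<one> / 2) *\<^sub>C x" if \<phi>: "linear_form (algebra_space \<A>) \<phi>" for \<phi>
  proof -
    note z = coloring_zero_block[OF U col \<phi>]
    have "A (slice \<phi> ?P * x) = slice \<phi> ?Q * A x"
      by (rule coloring_intertwines[OF U \<phi> carr carr one z z])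
    moreover have "A (slice \<phi> ?Q * x) = slice \<phi> ?P * A x"
      by (rule coloring_intertwines[OF U \<phi> carr carr _ z z]) (simp add: one add.commute)
    ultimately have "A (slice \<phi> ?P * x - slice \<phi> ?Q * x) = (- c) *\<^sub>C (slice \<phi> ?P * x - slice \<phi> ?Q * x)"
      by (simp add: A_diff x mult_scaleC_right cvs.scale_right_diff_distrib)
    then have "slice \<phi> ?P * x - slice \<phi> ?Q * x = 0" using not spec_iff by blast
    moreover have "slice \<phi> ?P * x + slice \<phi> ?Q * x = \<phi> \<one> *\<^sub>C x"
      by (simp add: distrib_right[symmetric] one[OF \<phi>] mult_scaleC_left)
    ultimately have "2 *\<^sub>C (slice \<phi> ?P * x) = \<phi> \<one> *\<^sub>C x"
      using scaleC_add_left[of 1 1 "slice \<phi> ?P * x"] by (simp add: scaleC_one)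
    then have "(1 / 2) *\<^sub>C 2 *\<^sub>C (slice \<phi> ?P * x) = (1 / 2) *\<^sub>C \<phi> \<one> *\<^sub>C x" by simp
    then show ?thesis by (simp add: scaleC_scaleC scaleC_one)
  qed
  obtain \<phi> where \<phi>: "linear_form (algebra_space \<A>) \<phi>" "\<phi> \<one> = 1"
    using linear_form_unital[OF U ne] by blast
  have "slice \<phi> ?P * x = slice \<phi> (tensor_prod (*) (mult \<A>) ?P ?P) * x"
    using slice_eq[OF idem \<phi>(1)] by simp
  also have "\<dots> = (\<Sum>(y, a)\<leftarrow>?P. \<Sum>(y', b)\<leftarrow>?P. \<phi> (a \<otimes> b) *\<^sub>C (y * y' * x))"
    unfolding slice_mult by (simp add: sum_tensor_prod)
  also have "\<dots> = (\<Sum>(y, a)\<leftarrow>?P. y * ((\<phi> a / 2) *\<^sub>C x))"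
  proof -
    have "(\<Sum>(y', b)\<leftarrow>?P. \<phi> (a \<otimes> b) *\<^sub>C (y * y' * x)) = y * ((\<phi> a / 2) *\<^sub>C x)"
      if a: "a \<in> carrier \<A>" for y a
    proof -
      have c: "clinear (\<lambda>u. y * u)" by (simp add: clinear_iff distrib_left mult_scaleC_right)
      have "(\<Sum>(y', b)\<leftarrow>?P. \<phi> (a \<otimes> b) *\<^sub>C (y * y' * x)) = y * (slice (\<lambda>b. \<phi> (a \<otimes> b)) ?P * x)"
        unfolding slice_mult by (subst clinear_sum_list[OF c]) (simp add: mult_scaleC_right mult.assoc)
      then show ?thesis using half[OF linear_form_translate(2)[OF U \<phi>(1) a]] a by (simp add: D)
    qed
    then show ?thesis
      using carr[of "pt 1"] by (intro arg_cong[of _ _ sum_list] map_cong) auto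
  qed
  also have "\<dots> = (1 / 2) *\<^sub>C (slice \<phi> ?P * x)"
  proof -
    have c: "clinear (\<lambda>u. (1 / 2) *\<^sub>C (u :: 'b))" by (simp add: clinear_iff scaleC_add_right scaleC_scaleC)
    show ?thesis unfolding slice_mult
      by (subst clinear_sum_list[OF c]) (simp add: mult_scaleC_right scaleC_scaleC)
  qed
  finally have "slice \<phi> ?P * x = (1 / 2) *\<^sub>C (slice \<phi> ?P * x)" .
  then have "(1 / 2) *\<^sub>C x = (1 / 4) *\<^sub>C x" using half[OF \<phi>(1)] \<phi>(2) by (simp add: scaleC_scaleC)
  then show False using x(1) by simp
qed

text \<open>Multiplication by the symmetry \<open>p - (1 - p)\<close> of a bipartition is an involution that
  anticommutes with \<open>A\<close>; it exchanges the eigenspaces of \<open>c\<close> and \<open>- c\<close>.\<close>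

lemma bipartition_symmetry:
  assumes p: "projection p" and sw: "\<And>b. A (p * b) = (1 - p) * A b"
  shows "(p - (1 - p)) * (p - (1 - p)) = 1" and "A ((p - (1 - p)) * b) = - ((p - (1 - p)) * A b)"
proof -
  have "p * p = p" using p by (simp add: projection_def)
  then show "(p - (1 - p)) * (p - (1 - p)) = 1" by (simp add: algebra_simps)
  show "A ((p - (1 - p)) * b) = - ((p - (1 - p)) * A b)"
    by (simp add: left_diff_distrib A_diff sw)
qed

lemma eigen_multiplicity_symmetric:
  assumes p: "projection p" and sw: "\<And>b. A (p * b) = (1 - p) * A b"
  shows "eigen_multiplicity A c = eigen_multiplicity A (- c)"
proof -
  let ?u = "p - (1 - p)"
  note u = bipartition_symmetry[OF p sw]
  have uu: "?u * (?u * y) = y" for y using u(1) by (simp only: mult.assoc[symmetric] mult_1_left)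
  have maps: "A (?u * y) = (- c) *\<^sub>C (?u * y)" if "A y = c *\<^sub>C y" for y c
    unfolding u(2) that by (simp add: mult_scaleC_right)
  have image: "(\<lambda>y. ?u * y) ` {x. A x = c *\<^sub>C x} = {x. A x = (- c) *\<^sub>C x}"
  proof (intro equalityI subsetI)
    fix x assume x: "x \<in> {x. A x = (- c) *\<^sub>C x}"
    then have "A (?u * x) = c *\<^sub>C (?u * x)" using maps[of x "- c"] by simp
    then show "x \<in> (\<lambda>y. ?u * y) ` {x. A x = c *\<^sub>C x}"
      by (intro image_eqI[of _ _ "?u * x"]) (simp_all only: uu mem_Collect_eq)
  qed (use maps in blast)
  have lin_u: "clinear (\<lambda>y. ?u * y)" by (simp only: clinear_iff distrib_left mult_scaleC_right simp_thms)
  have inj: "inj_on (\<lambda>y. ?u * y) X" for X by (rule inj_onI) (metis uu)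
  obtain B where "finite_dimensional_vector_space ((*\<^sub>C) :: complex \<Rightarrow> 'b \<Rightarrow> 'b) B"
    using finite_dimensional by blast
  then interpret fd: finite_dimensional_vector_space "(*\<^sub>C) :: complex \<Rightarrow> 'b \<Rightarrow> 'b" B .
  interpret fdp: finite_dimensional_vector_space_pair_1 "(*\<^sub>C) :: complex \<Rightarrow> 'b \<Rightarrow> 'b" B "(*\<^sub>C) :: complex \<Rightarrow> 'b \<Rightarrow> 'b"
    by unfold_locales
  show ?thesis
    unfolding eigen_multiplicity_def image[symmetric]
    by (rule fdp.dim_image_eq[OF lin_u inj, symmetric])
qed

section \<open>The equivalences\<close>

lemma degree_in_spec: "d \<in> spec A"
  using spec_iff[of d] A_one by (auto intro!: exI[of _ 1])

lemma bipartite_iff: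
  "bipartite \<psi> A \<longleftrightarrow> (\<exists>p. projection p \<and> p \<noteq> 0 \<and> p \<noteq> 1 \<and> (\<forall>b. A (p * b) = (1 - p) * A b))"
proof
  assume "bipartite \<psi> A"
  then obtain f where f: "graph_hom \<psi> A tau adj_K2 f" "inj f"
    by (auto simp: bipartite_def surjective_graph_hom_def)
  define p where "p = f (pt 1)"
  have "unital_star_hom f" using f(1) by (simp add: graph_hom_def)
  then have p: "f = splitting p" "projection p" unfolding p_def by (rule unital_star_hom_splitting)+
  have inj: "inj (splitting p)" using f(2) p(1) by metis
  have "splitting p (pt 1) \<noteq> splitting p 0" "splitting p (pt 2) \<noteq> splitting p 0"
    unfolding inj_eq[OF inj] by (simp_all add: vec_eq_iff)
  moreover have "splitting p 0 = 0" by (simp add: splitting_def)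
  ultimately have "p \<noteq> 0" "p \<noteq> 1" by auto
  then show "\<exists>p. projection p \<and> p \<noteq> 0 \<and> p \<noteq> 1 \<and> (\<forall>b. A (p * b) = (1 - p) * A b)"
    using p f(1) graph_hom_K2_iff[OF state linear_A p(2)] bipartition_iff[OF p(2)] by auto
next
  assume "\<exists>p. projection p \<and> p \<noteq> 0 \<and> p \<noteq> 1 \<and> (\<forall>b. A (p * b) = (1 - p) * A b)"
  then obtain p where p: "projection p" "p \<noteq> 0" "p \<noteq> 1" "\<forall>b. A (p * b) = (1 - p) * A b" by blast
  then have "graph_hom \<psi> A tau adj_K2 (splitting p)"
    using graph_hom_K2_iff[OF state linear_A p(1)] bipartition_iff[OF p(1)] by auto
  then show "bipartite \<psi> A"
    using splitting_inj[OF p(1-3)] by (auto simp: bipartite_def surjective_graph_hom_def)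
qed

text \<open>A bipartition produces the eigenvector \<open>p - (1 - p)\<close> of \<open>- d\<close>. Conversely an eigenvector of
  \<open>- d\<close> is orthogonal to \<open>1\<close> if \<open>d \<noteq> 0\<close>, because \<open>\<psi> A = d \<psi>\<close>, and can be chosen so if \<open>d = 0\<close>.\<close>

lemma bipartite_iff_spec:
  assumes con: "connected_graph \<psi> A"
  shows "bipartite \<psi> A \<longleftrightarrow> - d \<in> spec A \<and> (d = 0 \<longrightarrow> cdim (UNIV :: 'b set) \<ge> 2)"
proof
  assume "bipartite \<psi> A"
  then obtain p where p: "projection p" "p \<noteq> 0" "p \<noteq> 1" "\<And>b. A (p * b) = (1 - p) * A b"
    using bipartite_iff by blast
  let ?u = "p - (1 - p)"
  have "A ?u = (- d) *\<^sub>C ?u" using bipartition_symmetry(2)[OF p(1,4), of 1] by (simp add: A_one mult_scaleC_right)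
  moreover have "?u \<noteq> 0" using bipartition_symmetry(1)[OF p(1,4)] by auto
  ultimately have "- d \<in> spec A" using spec_iff by blast
  moreover have "cdim (UNIV :: 'b set) \<ge> 2"
  proof -
    have "p \<noteq> \<psi> p *\<^sub>C 1"
    proof
      assume e: "p = \<psi> p *\<^sub>C 1"
      have "p * p = p" using p(1) by (simp add: projection_def)
      then have "\<psi> p *\<^sub>C p = p" using arg_cong[OF e, of "\<lambda>x. x * p"] by (simp add: mult_scaleC_left)
      then have "\<psi> p = 1" using p(2) cvs.scale_right_imp_eq[of p "\<psi> p" 1] by (simp add: scaleC_one)
      then show False using e p(3) by (simp add: scaleC_one)
    qed
    then show ?thesis unfolding dim_ge_2_iff
      using faithful_stateD(2)[OF state]
      by (intro exI[of _ "p - \<psi> p *\<^sub>C 1"]) (simp add: psi_diff psi_scale)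
  qed
  ultimately show "- d \<in> spec A \<and> (d = 0 \<longrightarrow> cdim (UNIV :: 'b set) \<ge> 2)" by blast
next
  assume *: "- d \<in> spec A \<and> (d = 0 \<longrightarrow> cdim (UNIV :: 'b set) \<ge> 2)"
  have "\<exists>y. y \<noteq> 0 \<and> A y = (- d) *\<^sub>C y \<and> \<psi> y = 0"
  proof (cases "d = 0")
    case True
    then show ?thesis using * degree_zero dim_ge_2_iff by auto
  next
    case False
    obtain y where y: "y \<noteq> 0" "A y = (- d) *\<^sub>C y" using *[THEN conjunct1, unfolded spec_iff] by blast
    have "d * \<psi> y = - d * \<psi> y" using psi_A[of y] unfolding y(2) by (simp add: psi_scale clinear_minus[OF lin])
    then show ?thesis using y False by auto
  qed
  then show "bipartite \<psi> A" unfolding bipartite_iff using bipartition_of_eigenvector[OF con] by blast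
qed

text \<open>In degree \<open>0\<close> and dimension \<open>1\<close> the graph has no edges, and the improper bipartition
  \<open>p = 1\<close> is good enough for a coloring.\<close>

lemma bipartition_of_symmetric_spectrum:
  assumes con: "connected_graph \<psi> A" and sym: "spec A = uminus ` spec A"
  shows "\<exists>p. projection p \<and> (\<forall>b. A (p * b) = (1 - p) * A b)"
proof (cases "d = 0 \<longrightarrow> cdim (UNIV :: 'b set) \<ge> 2")
  case True
  have "- d \<in> spec A" using sym degree_in_spec by blast
  then show ?thesis using bipartite_iff_spec[OF con] bipartite_iff True by blast
next
  case False
  then show ?thesis using degree_zero by (intro exI[of _ 1]) (simp add: projection_def)
qed

lemma symmetric_spectrum_of_coloring:
  assumes "unital_star_algebra \<A>" "carrier \<A> \<noteq> {zero \<A>}" "two_coloring \<psi> A \<A> f"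
  shows "spec A = uminus ` spec A"
proof (intro equalityI subsetI)
  note s = spec_symmetric_of_coloring[OF assms]
  fix c assume "c \<in> spec A"
  then show "c \<in> uminus ` spec A" using s[of c] by (intro image_eqI[of _ _ "- c"]) auto
qed (use spec_symmetric_of_coloring[OF assms] in auto)

lemma alg_colorable_iff:
  fixes emb :: "complex \<Rightarrow> 'u"
  assumes con: "connected_graph \<psi> A" and emb: "inj emb"
  shows "alg_2_colorable TYPE('u) \<psi> A \<longleftrightarrow> spec A = uminus ` spec A"
proof
  assume "alg_2_colorable TYPE('u) \<psi> A"
  then show "spec A = uminus ` spec A"
    unfolding alg_2_colorable_def using symmetric_spectrum_of_coloring by blast
next
  assume "spec A = uminus ` spec A"
  then obtain p where "projection p" "\<And>b. A (p * b) = (1 - p) * A b"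
    using bipartition_of_symmetric_spectrum[OF con] by blast
  then show "alg_2_colorable TYPE('u) \<psi> A"
    unfolding alg_2_colorable_def
    using copy_algebra[OF emb] two_coloring_of_bipartition[OF copy_algebra(1)[OF emb]] by blast
qed

lemma loc_colorable_iff:
  assumes con: "connected_graph \<psi> A"
  shows "loc_2_colorable \<psi> A \<longleftrightarrow> spec A = uminus ` spec A"
proof
  note C = copy_algebra[OF inj_on_id, unfolded copy_algebra_id]
  { assume "loc_2_colorable \<psi> A"
    then show "spec A = uminus ` spec A"
      unfolding loc_2_colorable_def using symmetric_spectrum_of_coloring[OF C] by blast }
  assume "spec A = uminus ` spec A"
  then obtain p where "projection p" "\<And>b. A (p * b) = (1 - p) * A b"
    using bipartition_of_symmetric_spectrum[OF con] by blast
  then show "loc_2_colorable \<psi> A"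
    unfolding loc_2_colorable_def using two_coloring_of_bipartition[OF C(1)] by blast
qed

end

theorem corollary4p14:
  fixes \<psi> :: "'b::fd_cstar_algebra \<Rightarrow> complex"
    and A :: "'b \<Rightarrow> 'b"
    and d :: complex
    and emb :: "complex \<Rightarrow> 'u"
  assumes "quantum_graph \<psi> A"
    and "connected_graph \<psi> A"
    and "regular \<psi> A d"
    and "undirected \<psi> A"
    and "tracial \<psi>"
    and "inj emb"
  shows "(loc_2_colorable \<psi> A \<longleftrightarrow> alg_2_colorable TYPE('u) \<psi> A) \<and>
    (alg_2_colorable TYPE('u) \<psi> A \<longleftrightarrow> spec A = uminus ` spec A) \<and>
    ((d = 0 \<longrightarrow> cdim (UNIV :: 'b set) \<ge> 2) \<longrightarrow>
       (spec A = uminus ` spec A \<longleftrightarrow>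
        - d \<in> spec A \<and> (d = 0 \<longrightarrow> cdim (UNIV :: 'b set) \<ge> 2))) \<and>
    (- d \<in> spec A \<and> (d = 0 \<longrightarrow> cdim (UNIV :: 'b set) \<ge> 2) \<longleftrightarrow> bipartite \<psi> A) \<and>
    (spec A = uminus ` spec A \<longrightarrow>
       (\<forall>c. eigen_multiplicity A c = eigen_multiplicity A (- c)))"
proof -
  have st: "faithful_state \<psi>" and lA: "clinear A" and idem: "schur \<psi> A A = A"
    and ex: "\<exists>\<delta>. delta_form \<psi> \<delta>"
    using assms(1) by (auto simp: quantum_graph_def quantum_set_def)
  obtain E where "parseval_frame \<psi> E" using parseval_frame_exists[OF st] by blast
  then interpret tracial_frame \<psi> E
    using assms(5) by (simp add: tracial_frame_def tracial_frame_axioms_def tracial_def)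
  have real: "A (star x) = star (A x)" for x
    using assms(4) by (metis undirected_def real_graph_def op_star_def star_star)
  interpret regular_graph \<psi> E A d
  proof (rule regular_graph.intro[OF tracial_frame_axioms regular_graph_axioms.intro])
    show "delta \<psi> \<noteq> 0" using ex delta_form_nonzero delta_eq by blast
    show "\<psi> (x * A y) = \<psi> (A x * y)" for x y
    proof -
      have "adjoint_op \<psi> \<psi> A = A" using assms(4) by (simp add: undirected_def)
      then have "\<psi> (star (A (star x)) * y) = \<psi> (star (star x) * A y)"
        using adjoint_op(2)[OF st lA, of "star x" y] by (simp add: l2_inner_def)
      then show ?thesis by (simp add: real star_star)
    qed
    show "A 1 = d *\<^sub>C 1" using assms(3) by (simp add: regular_def)
  qed (fact lA idem real)+
  note con = assms(2)
  note loc = loc_colorable_iff[OF con] and alg = alg_colorable_iff[OF con assms(6)]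
  have "spec A = uminus ` spec A" if b: "bipartite \<psi> A"
  proof -
    obtain p where "projection p" "\<And>b. A (p * b) = (1 - p) * A b" using b bipartite_iff by blast
    then show ?thesis
      using symmetric_spectrum_of_coloring[OF copy_algebra[OF assms(6)]]
        two_coloring_of_bipartition[OF copy_algebra(1)[OF assms(6)]] by blast
  qed
  moreover have "- d \<in> spec A" if "spec A = uminus ` spec A" using that degree_in_spec by blast
  moreover have "eigen_multiplicity A c = eigen_multiplicity A (- c)" if "spec A = uminus ` spec A" for c
    using bipartition_of_symmetric_spectrum[OF con that] eigen_multiplicity_symmetric by blast
  ultimately show ?thesis using loc alg bipartite_iff_spec[OF con] by blast
qed

end
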